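(* (1) Let $n=2m+1\ge 3$ and let $a\in\mathbb{C}^n$ be fixed. For generic $c\in T_c=(\mathbb{C}^* )^{n-1}$, $P_n(t,\lambda)$ is reducible in $\mathbb{C}[t,\lambda]$ if and only if $a_1=a_3=\cdots=a_{2m+1}$. (2) Let $n=2m\ge 4$ and let $a\in\mathbb{C}^n$ be fixed. For generic $c\in T_c=(\mathbb{C}^* )^{n-1}$, $P_n(t,\lambda)$ is reducible in $\mathbb{C}[t,\lambda]$ if and only if $a_1=a_3=\cdots=a_{2m-1}$ and $a_2=a_4=\cdots=a_{2m}$.
   Context: For $a=(a_1,\dots,a_n)\in\mathbb{C}^n$ and $c=(c_1,\dots,c_{n-1})\in\mathbb{C}^{n-1}$, the reduced continuant $P_n(t,\lambda)\in\mathbb{C}[t,\lambda]$ is defined by $P_0=1$, $P_1=\lambda+a_1$, $P_k=(\lambda+a_k)P_{k-1}-t\,c_{k-1}P_{k-2}$ for $2\le k\le n$. $T_c=(\mathbb{C}^* )^{n-1}$ is the torus of coupling vectors $c$ with all $c_i\neq0$. "For generic $c\in T_c$" means for all $c$ outside a proper Zariski closed subset of $T_c$. *)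

theory Defs
  imports
    "HOL-Computational_Algebra.Computational_Algebra"
    "HOL-Library.FuncSet"
    "HOL-Library.Poly_Mapping"
begin

text \<open>
  The ring $C[t,\lambda]$ is rendered as \<^typ>\<open>complex poly poly\<close>: the outer variable
  is $\lambda$, the variable of the coefficient ring is $t$.
\<close>

definition var_lam :: "complex poly poly" where
  "var_lam = [:0, 1:]"

definition var_t :: "complex poly poly" where
  "var_t = [:[:0, 1:]:]"

definition cnst :: "complex \<Rightarrow> complex poly poly" where
  "cnst z = [:[:z:]:]"

text \<open>
  Vectors are functions on \<^typ>\<open>nat\<close> with indices starting at 1; \<open>reduced_continuant a c n\<close>
  reads only \<open>a 1, \<dots>, a n\<close> and \<open>c 1, \<dots>, c (n - 1)\<close>.
\<close>

fun reduced_continuant ::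
    "(nat \<Rightarrow> complex) \<Rightarrow> (nat \<Rightarrow> complex) \<Rightarrow> nat \<Rightarrow> complex poly poly" where
  "reduced_continuant a c 0 = 1"
| "reduced_continuant a c (Suc 0) = var_lam + cnst (a 1)"
| "reduced_continuant a c (Suc (Suc k)) =
     (var_lam + cnst (a (k + 2))) * reduced_continuant a c (Suc k)
       - var_t * cnst (c (k + 1)) * reduced_continuant a c k"

definition reducible :: "'a::comm_semiring_1 \<Rightarrow> bool" where
  "reducible p \<longleftrightarrow> p \<noteq> 0 \<and> \<not> p dvd 1 \<and> \<not> irreducible p"

text \<open>
  The torus $(C^*)^k$. Its points are extensional functions, so each vector of coordinates
  $(c_1,\dots,c_k)$ corresponds to exactly one point.
\<close>

definition torus :: "nat \<Rightarrow> (nat \<Rightarrow> complex) set" where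
  "torus k = {1..k} \<rightarrow>\<^sub>E (UNIV - {0})"

text \<open>
  A multivariate polynomial is a finitely supported map from monomials (exponent vectors)
  to coefficients.
\<close>

type_synonym cmpoly = "(nat \<Rightarrow>\<^sub>0 nat) \<Rightarrow>\<^sub>0 complex"

definition mpolys :: "nat \<Rightarrow> cmpoly set" where
  "mpolys k = {p. \<forall>m \<in> Poly_Mapping.keys p. Poly_Mapping.keys m \<subseteq> {1..k}}"

definition mpoly_eval :: "(nat \<Rightarrow> complex) \<Rightarrow> cmpoly \<Rightarrow> complex" where
  "mpoly_eval c p =
     (\<Sum>m \<in> Poly_Mapping.keys p. Poly_Mapping.lookup p m *
        (\<Prod>i \<in> Poly_Mapping.keys m. c i ^ Poly_Mapping.lookup m i))"

text \<open>
  The Zariski topology of the torus is the subspace topology from affine space. Using Laurent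
  polynomials instead would give the same closed sets, since monomials are units on the torus.
\<close>

definition zariski_closed_in_torus :: "nat \<Rightarrow> (nat \<Rightarrow> complex) set \<Rightarrow> bool" where
  "zariski_closed_in_torus k Z \<longleftrightarrow>
     (\<exists>S \<subseteq> mpolys k. Z = {c \<in> torus k. \<forall>p \<in> S. mpoly_eval c p = 0})"

definition for_generic :: "nat \<Rightarrow> ((nat \<Rightarrow> complex) \<Rightarrow> bool) \<Rightarrow> bool" where
  "for_generic k Q \<longleftrightarrow>
     (\<exists>Z. zariski_closed_in_torus k Z \<and> Z \<noteq> torus k \<and> (\<forall>c \<in> torus k - Z. Q c))"

end

theory Submission
  imports Defs "Subresultants.Subresultant_Gcd" "HOL-Computational_Algebra.Field_as_Ring"
begin

text \<open>
  Reducibility in the exceptional cases holds for every coupling vector. The continuant is a sum over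
  the matchings of a path, to which an uncovered vertex $k$ contributes the factor $\lambda+a_k$. A
  matching of a path with an odd number of vertices leaves an odd vertex uncovered, so if all odd
  entries equal $y$, then $\lambda+y$ divides $P_n$ (\<open>reducible_if_odd_entries_equal\<close>). If $n=2m$,
  all odd entries equal $y$ and all even entries equal $z$, then $P_n$ is a binary form of degree $m$ in $t$ and
  $(\lambda+y)(\lambda+z)$, and binary forms over $\mathbb{C}$ split into linear forms
  (\<open>reducible_if_entries_alternate\<close>).

  In all other cases it suffices to find one coupling vector with nonzero coordinates for which
  $P_n$ is irreducible, because irreducibility is a Zariski open condition on $c$
  (\<open>irreducible_reduced_continuant_is_open\<close>). Openness is proved by explicit elimination
  (\<open>no_splitting_is_open\<close>). A factor of $P_n$ that is monic in $\lambda$ is determined, by Lagrange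
  interpolation in $t$, by its specializations at finitely many values of $t$, hence by roots of
  the specializations of $P_n$. The existence of a factorization with prescribed degrees thus
  becomes the solvability of a polynomial equation in unknowns each of which is a root of a monic
  polynomial with coefficients polynomial in $c$. Such unknowns are eliminated one at a time by
  resultants (\<open>eliminate_roots\<close>), which leaves a polynomial in $c$ alone.

  One good coupling vector is found by induction on $n$ (\<open>irreducible_coupling_odd_even\<close>). For
  $c_n=0$ the continuant $P_{n+1}$ degenerates to $(\lambda+a_{n+1})P_n$. If $P_n$ is irreducible,
  this product has no factorization with both degrees at least two, and by openness neither has
  $P_{n+1}$ for all but finitely many values of $c_n$. Linear factors are excluded separately: they
  must be of the form $\lambda+a_i$, which is impossible for even $n+1$ and $c_n\neq0$, and possible
  for at most one $c_n$ per $i$ for odd $n+1$, provided that $P_{n-1}$ does not vanish at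
  $\lambda=-a_{n+1}$ (\<open>irreducible_coupling_extend\<close>). The class of exceptional $a$ is such that for
  every other $a$, possibly after reversing it, dropping the last entry leads to a vector to which
  the induction hypothesis applies; in size two there are no exceptional vectors.
\<close>

section \<open>Polynomial functions and the elimination of roots\<close>

text \<open>
  Polynomials in the coordinates with index in \<open>V\<close>, taken as functions: over $\mathbb{C}$ nothing is
  lost, and one polynomial can be evaluated at vectors whose coordinates outside \<open>V\<close> serve as
  further unknowns.
\<close>

inductive_set polyfun :: "nat set \<Rightarrow> ((nat \<Rightarrow> complex) \<Rightarrow> complex) set" for V where
  const: "(\<lambda>v. z) \<in> polyfun V"
| var: "i \<in> V \<Longrightarrow> (\<lambda>v. v i) \<in> polyfun V"
| add: "f \<in> polyfun V \<Longrightarrow> g \<in> polyfun V \<Longrightarrow> (\<lambda>v. f v + g v) \<in> polyfun V"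
| mult: "f \<in> polyfun V \<Longrightarrow> g \<in> polyfun V \<Longrightarrow> (\<lambda>v. f v * g v) \<in> polyfun V"

lemma polyfun_mono: "f \<in> polyfun V \<Longrightarrow> V \<subseteq> W \<Longrightarrow> f \<in> polyfun W"
  by (induction rule: polyfun.induct) (auto intro: polyfun.intros)

lemma polyfun_diff: "f \<in> polyfun V \<Longrightarrow> g \<in> polyfun V \<Longrightarrow> (\<lambda>v. f v - g v) \<in> polyfun V"
  using polyfun.add[OF _ polyfun.mult[OF polyfun.const[of "-1"]], of f V g] by simp

lemma polyfun_sum:
  "(\<And>a. a \<in> A \<Longrightarrow> f a \<in> polyfun V) \<Longrightarrow> (\<lambda>v. \<Sum>a\<in>A. f a v) \<in> polyfun V"
  by (induction A rule: infinite_finite_induct) (auto intro: polyfun.intros)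

lemma polyfun_prod:
  "(\<And>a. a \<in> A \<Longrightarrow> f a \<in> polyfun V) \<Longrightarrow> (\<lambda>v. \<Prod>a\<in>A. f a v) \<in> polyfun V"
  by (induction A rule: infinite_finite_induct) (auto intro: polyfun.intros)

lemma polyfun_cong:
  "f \<in> polyfun V \<Longrightarrow> (\<And>i. i \<in> V \<Longrightarrow> v i = w i) \<Longrightarrow> f v = f w"
  by (induction rule: polyfun.induct) auto

text \<open>
  Genericity questions are reduced to one parameter by restricting to a polynomial curve.
\<close>

lemma polyfun_along_curve:
  assumes "f \<in> polyfun V" "\<And>i. i \<in> V \<Longrightarrow> \<exists>q. \<forall>s. w s i = poly q s"
  shows "\<exists>q. \<forall>s. f (w s) = poly q s"
  using assms
proof (induction rule: polyfun.induct)
  case (const z)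
  have "\<forall>s. z = poly [:z:] s" by simp
  then show ?case by blast
next
  case (add f g)
  then obtain q r where "\<forall>s. f (w s) = poly q s" "\<forall>s. g (w s) = poly r s" by meson
  then have "\<forall>s. f (w s) + g (w s) = poly (q + r) s" by simp
  then show ?case by blast
next
  case (mult f g)
  then obtain q r where "\<forall>s. f (w s) = poly q s" "\<forall>s. g (w s) = poly r s" by meson
  then have "\<forall>s. f (w s) * g (w s) = poly (q * r) s" by simp
  then show ?case by blast
qed simp

text \<open>
  The degree bound is uniform in the remaining coordinates; this is what allows Sylvester matrices
  of a fixed size below.
\<close>

lemma polyfun_as_univariate:
  assumes "f \<in> polyfun (insert w V)"
  shows "\<exists>H M. (\<forall>v. degree (H v) \<le> M) \<and> (\<forall>j. (\<lambda>v. coeff (H v) j) \<in> polyfun V) \<and>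
    (\<forall>v x. f (v(w := x)) = poly (H v) x)"
  using assms
proof (induction rule: polyfun.induct)
  case (const z)
  show ?case
    by (intro exI[of _ "\<lambda>_. [:z:]"] exI[of _ 0]) (auto intro: polyfun.intros)
next
  case (var i)
  show ?case
  proof (cases "i = w")
    case True
    then show ?thesis
      by (intro exI[of _ "\<lambda>_. [:0, 1:]"] exI[of _ 1]) (auto intro: polyfun.intros)
  next
    case False
    have "(\<lambda>v. coeff [:v i:] j) \<in> polyfun V" for j
      using var False by (cases j) (auto intro: polyfun.intros)
    then show ?thesis using False
      by (intro exI[of _ "\<lambda>v. [:v i:]"] exI[of _ 0]) auto
  qed
next
  case (add f g)
  then obtain H M H' M' where
    H: "\<forall>v. degree (H v) \<le> M" "\<forall>j. (\<lambda>v. coeff (H v) j) \<in> polyfun V"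
      "\<And>v x. f (v(w := x)) = poly (H v) x" and
    H': "\<forall>v. degree (H' v) \<le> M'" "\<forall>j. (\<lambda>v. coeff (H' v) j) \<in> polyfun V"
      "\<And>v x. g (v(w := x)) = poly (H' v) x" by blast
  have "degree (H v + H' v) \<le> max M M'" for v
    using H(1) H'(1) by (meson degree_add_le max.cobounded1 max.cobounded2 order_trans)
  then show ?case using H(2) H'(2)
    by (intro exI[of _ "\<lambda>v. H v + H' v"] exI[of _ "max M M'"])
      (simp add: H(3) H'(3) polyfun.add del: fun_upd_apply)
next
  case (mult f g)
  then obtain H M H' M' where
    H: "\<forall>v. degree (H v) \<le> M" "\<forall>j. (\<lambda>v. coeff (H v) j) \<in> polyfun V"
      "\<And>v x. f (v(w := x)) = poly (H v) x" and
    H': "\<forall>v. degree (H' v) \<le> M'" "\<forall>j. (\<lambda>v. coeff (H' v) j) \<in> polyfun V"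
      "\<And>v x. g (v(w := x)) = poly (H' v) x" by blast
  have "degree (H v * H' v) \<le> M + M'" for v
    using H(1) H'(1) by (meson add_mono degree_mult_le order_trans)
  moreover have "(\<lambda>v. coeff (H v * H' v) j) \<in> polyfun V" for j
    unfolding coeff_mult using H(2) H'(2) by (intro polyfun_sum polyfun.mult) auto
  ultimately show ?case
    by (intro exI[of _ "\<lambda>v. H v * H' v"] exI[of _ "M + M'"])
      (simp add: H(3) H'(3) del: fun_upd_apply)
qed

lemma polyfun_det:
  assumes "\<And>v. dim_row (A v) = n" "\<And>v. dim_col (A v) = n"
    and "\<And>i j. i < n \<Longrightarrow> j < n \<Longrightarrow> (\<lambda>v. A v $$ (i, j)) \<in> polyfun V"
  shows "(\<lambda>v. det (A v)) \<in> polyfun V"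
  unfolding det_def assms(1,2)
proof (simp, intro polyfun_sum polyfun.mult polyfun_prod polyfun.const assms(3))
  fix p i assume "p \<in> {p. p permutes {0..<n}}" "i \<in> {0..<n}"
  then show "i < n" "p i < n" using permutes_in_image[of p "{0..<n}" i] by auto
qed

lemma resultant_eq_0_iff_common_root:
  fixes p q :: "complex poly"
  assumes "p \<noteq> 0"
  shows "resultant p q = 0 \<longleftrightarrow> (\<exists>x. poly p x = 0 \<and> poly q x = 0)"
proof -
  have "degree (gcd p q) \<noteq> 0 \<longleftrightarrow> (\<exists>x. poly (gcd p q) x = 0)"
  proof
    assume "degree (gcd p q) \<noteq> 0"
    then have "\<not> constant (poly (gcd p q))" by (simp add: constant_degree)
    then show "\<exists>x. poly (gcd p q) x = 0"
      by (rule fundamental_theorem_of_algebra)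
  next
    assume "\<exists>x. poly (gcd p q) x = 0"
    then obtain x where "[:-x, 1:] dvd gcd p q" by (auto simp: poly_eq_0_iff_dvd)
    then have "degree [:-x, 1:] \<le> degree (gcd p q)" using assms
      by (intro dvd_imp_degree_le) auto
    then show "degree (gcd p q) \<noteq> 0" by simp
  qed
  then show ?thesis unfolding resultant_0_gcd by (simp add: poly_eq_0_iff_dvd)
qed

lemma polyfun_if:
  "(b \<Longrightarrow> f \<in> polyfun V) \<Longrightarrow> (\<not> b \<Longrightarrow> g \<in> polyfun V) \<Longrightarrow>
    (\<lambda>v. if b then f v else g v) \<in> polyfun V"
  by (cases b) simp_all

text \<open>
  The polynomial \<open>D\<close> is the resultant of \<open>p\<close> and of \<open>f\<close> read as a polynomial in the coordinate \<open>w\<close>.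
  Its vanishing detects a common root because \<open>p\<close> is monic.
\<close>

lemma eliminate_one_root:
  assumes f: "f \<in> polyfun (insert w V)"
    and p: "\<And>v. lead_coeff (p v) = 1" "\<And>v. degree (p v) = d"
      "\<And>j. (\<lambda>v. coeff (p v) j) \<in> polyfun V"
  shows "\<exists>D\<in>polyfun V. \<forall>v. D v = 0 \<longleftrightarrow> (\<exists>x. poly (p v) x = 0 \<and> f (v(w := x)) = 0)"
proof -
  obtain H M where H: "\<And>v. degree (H v) \<le> M" "\<And>j. (\<lambda>v. coeff (H v) j) \<in> polyfun V"
      "\<And>v x. f (v(w := x)) = poly (H v) x"
    using polyfun_as_univariate[OF f] by blast
  \<comment> \<open>Adding a high multiple of \<open>p v\<close> preserves the common roots and makes the degree independent
    of \<open>v\<close>, hence also the size of the Sylvester matrix.\<close>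
  define q where "q v = H v + monom 1 (M + 1) * p v" for v
  have p0: "p v \<noteq> 0" for v using p(1)[of v] by auto
  have deg_shift: "degree (monom 1 (M + 1) * p v) = M + 1 + d" for v
    using p0 p(2) by (subst degree_mult_eq) (auto simp: degree_monom_eq)
  have deg: "degree (q v) = M + 1 + d" for v
    unfolding q_def using H(1)[of v] deg_shift[of v] by (subst degree_add_eq_right) auto
  have "(\<lambda>v. coeff (monom 1 (M + 1) * p v) j) \<in> polyfun V" for j
    unfolding coeff_mult by (intro polyfun_sum polyfun.mult polyfun.const p)
  then have cq: "(\<lambda>v. coeff (q v) j) \<in> polyfun V" for j
    unfolding q_def coeff_add by (intro polyfun.add H)
  define D where "D v = det (sylvester_mat_sub d (M + 1 + d) (p v) (q v))" for v
  have "D \<in> polyfun V"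
    unfolding D_def
  proof (rule polyfun_det[of _ "d + (M + 1 + d)"])
    fix i j assume ij: "i < d + (M + 1 + d)" "j < d + (M + 1 + d)"
    show "(\<lambda>v. sylvester_mat_sub d (M + 1 + d) (p v) (q v) $$ (i, j)) \<in> polyfun V"
      unfolding sylvester_mat_sub_index[OF ij] by (intro polyfun_if p(3) cq polyfun.const)
  qed auto
  moreover have "D v = 0 \<longleftrightarrow> (\<exists>x. poly (p v) x = 0 \<and> f (v(w := x)) = 0)" for v
  proof -
    have "D v = resultant (p v) (q v)"
      by (simp only: D_def resultant_sub resultant_sub_def p(2) deg)
    then show ?thesis unfolding resultant_eq_0_iff_common_root[OF p0] H(3) q_def
      by (auto simp: resultant_eq_0_iff_common_root[OF p0])
  qed
  ultimately show ?thesis by blast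
qed

text \<open>
  If an unknown is integral over the coordinates in \<open>V\<close>, eliminating it yields an equation and not
  merely a constructible condition. As the polynomials \<open>p w\<close> involve only \<open>V\<close>, the unknowns can be
  removed independently, one after the other.
\<close>

lemma eliminate_roots:
  assumes "finite W" "V \<inter> W = {}" "f \<in> polyfun (V \<union> W)"
    and "\<And>w v. w \<in> W \<Longrightarrow> lead_coeff (p w v) = 1"
    and "\<And>w v. w \<in> W \<Longrightarrow> degree (p w v) = d"
    and "\<And>w j. w \<in> W \<Longrightarrow> (\<lambda>v. coeff (p w v) j) \<in> polyfun V"
  shows "\<exists>D\<in>polyfun V. \<forall>v. D v = 0 \<longleftrightarrow>
    (\<exists>u. (\<forall>i. i \<notin> W \<longrightarrow> u i = v i) \<and> (\<forall>w\<in>W. poly (p w v) (u w) = 0) \<and> f u = 0)"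
  using assms
proof (induction W arbitrary: f rule: finite_induct)
  case empty
  have "u = v" if "\<forall>i. u i = v i" for u v :: "nat \<Rightarrow> complex" using that by auto
  then show ?case using empty by (intro bexI[of _ f]) auto
next
  case (insert w W)
  have "\<exists>D\<in>polyfun (V \<union> W). \<forall>v. D v = 0 \<longleftrightarrow> (\<exists>x. poly (p w v) x = 0 \<and> f (v(w := x)) = 0)"
    using insert.prems by (intro eliminate_one_root[where d = d])
      (auto intro: polyfun_mono[of _ V])
  then obtain g where g: "g \<in> polyfun (V \<union> W)"
    "\<And>v. g v = 0 \<longleftrightarrow> (\<exists>x. poly (p w v) x = 0 \<and> f (v(w := x)) = 0)" by blast
  have "\<exists>D\<in>polyfun V. \<forall>v. D v = 0 \<longleftrightarrow>
    (\<exists>u. (\<forall>i. i \<notin> W \<longrightarrow> u i = v i) \<and> (\<forall>w\<in>W. poly (p w v) (u w) = 0) \<and> g u = 0)"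
    using insert.prems by (intro insert.IH g(1)) auto
  then obtain D where D: "D \<in> polyfun V" "\<And>v. D v = 0 \<longleftrightarrow>
    (\<exists>u. (\<forall>i. i \<notin> W \<longrightarrow> u i = v i) \<and> (\<forall>w\<in>W. poly (p w v) (u w) = 0) \<and> g u = 0)" by blast
  have pw: "p w u = p w v" if "\<forall>i. i \<notin> W \<longrightarrow> u i = v i" for u v
  proof (rule poly_eqI)
    fix j show "coeff (p w u) j = coeff (p w v) j"
      using that insert.prems
      by (intro polyfun_cong[of "\<lambda>v. coeff (p w v) j" V]) auto
  qed
  have "D v = 0 \<longleftrightarrow> (\<exists>u. (\<forall>i. i \<notin> insert w W \<longrightarrow> u i = v i) \<and>
      (\<forall>w\<in>insert w W. poly (p w v) (u w) = 0) \<and> f u = 0)" for v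
  proof
    assume "D v = 0"
    then obtain u x where u: "\<forall>i. i \<notin> W \<longrightarrow> u i = v i" "\<forall>w\<in>W. poly (p w v) (u w) = 0"
      and x: "poly (p w u) x = 0" "f (u(w := x)) = 0" using D(2) g(2) by blast
    show "\<exists>u. (\<forall>i. i \<notin> insert w W \<longrightarrow> u i = v i) \<and>
      (\<forall>w\<in>insert w W. poly (p w v) (u w) = 0) \<and> f u = 0"
      using u x pw[OF u(1)] insert.hyps by (intro exI[of _ "u(w := x)"]) auto
  next
    assume "\<exists>u. (\<forall>i. i \<notin> insert w W \<longrightarrow> u i = v i) \<and>
      (\<forall>w\<in>insert w W. poly (p w v) (u w) = 0) \<and> f u = 0"
    then obtain u where u: "\<forall>i. i \<notin> insert w W \<longrightarrow> u i = v i"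
      "\<forall>w\<in>insert w W. poly (p w v) (u w) = 0" "f u = 0" by blast
    \<comment> \<open>The coordinate \<open>w\<close> is free for \<open>g\<close>; it is reset to the value required outside \<open>W\<close>.\<close>
    let ?u = "u(w := v w)"
    have "\<forall>i. i \<notin> W \<longrightarrow> ?u i = v i" using u by auto
    moreover from pw[OF this] have "g ?u = 0" unfolding g(2) using u
      by (intro exI[of _ "u w"]) (simp del: fun_upd_apply)
    ultimately show "D v = 0" unfolding D(2) using u insert.hyps
      by (intro exI[of _ ?u]) auto
  qed
  then show ?case using D(1) by blast
qed

section \<open>Polynomials in two variables\<close>

text \<open>
  Specialization of $t$; the result is a polynomial in $\lambda$.
\<close>

definition at_t :: "complex \<Rightarrow> complex poly poly \<Rightarrow> complex poly" where
  "at_t t F = map_poly (\<lambda>q. poly q t) F"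

lemma at_t_mult: "at_t t (F * G) = at_t t F * at_t t G"
  unfolding at_t_def
  by (rule poly_eqI) (simp add: coeff_map_poly coeff_mult poly_sum)

lemma poly_at_t: "poly (at_t t F) l = poly (poly F [:l:]) t"
  unfolding at_t_def by (induction F) (simp_all add: map_poly_pCons)

lemma at_t_monic:
  assumes "lead_coeff F = 1"
  shows "degree (at_t t F) = degree F" "lead_coeff (at_t t F) = 1"
proof -
  have 1: "coeff (at_t t F) (degree F) = 1"
    using assms by (simp add: at_t_def coeff_map_poly)
  moreover have "degree (at_t t F) \<le> degree F" by (simp add: at_t_def degree_map_poly_le)
  ultimately show *: "degree (at_t t F) = degree F"
    by (metis le_antisym le_degree one_neq_zero)
  then show "lead_coeff (at_t t F) = 1" using 1 by simp
qed

lemma coeff_poly_const_arg: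
  "coeff (poly F [:l:]) d = poly (map_poly (\<lambda>q. coeff q d) F) l"
  for F :: "complex poly poly"
  by (induction F) (simp_all add: map_poly_pCons)

lemma degree_poly_const_arg_le:
  fixes F :: "complex poly poly"
  assumes "\<And>i. degree (coeff F i) \<le> N"
  shows "degree (poly F [:l:]) \<le> N"
proof (rule degree_le, intro allI impI)
  fix d assume "d > N"
  then have "map_poly (\<lambda>q. coeff q d) F = 0"
    by (intro poly_eqI) (simp add: coeff_map_poly coeff_eq_0 le_less_trans[OF assms])
  then show "coeff (poly F [:l:]) d = 0" by (simp add: coeff_poly_const_arg)
qed

lemma finite_const_roots:
  fixes F :: "complex poly poly"
  assumes "F \<noteq> 0"
  shows "finite {l. poly F [:l:] = 0}"
proof -
  have "finite ((\<lambda>l. [:l:]) ` {l. poly F [:l:] = 0})"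
    by (rule finite_subset[OF _ poly_roots_finite[OF assms]]) auto
  then show ?thesis by (rule finite_imageD) (auto intro: inj_onI)
qed

lemma nonzero_bivariate_value:
  fixes F :: "complex poly poly"
  assumes "F \<noteq> 0"
  obtains l t where "poly (poly F [:l:]) t \<noteq> 0"
proof -
  obtain l where "poly F [:l:] \<noteq> 0"
    using ex_new_if_finite[OF infinite_UNIV_char_0 finite_const_roots[OF assms]] by auto
  moreover from ex_new_if_finite[OF infinite_UNIV_char_0 poly_roots_finite[OF this]]
  obtain t where "poly (poly F [:l:]) t \<noteq> 0" by auto
  ultimately show ?thesis using that by blast
qed

text \<open>
  The degree in $t$ is additive. To see this with $\lambda$ as the outer variable, specialize $\lambda$ to a
  number at which neither the leading coefficient of \<open>F\<close> with respect to $t$ nor \<open>G\<close> vanishes.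
\<close>

lemma inner_degree_factor_le:
  fixes F G :: "complex poly poly"
  assumes "F \<noteq> 0" "G \<noteq> 0" and N: "\<And>i. degree (coeff (F * G) i) \<le> N"
  shows "degree (coeff F i) \<le> N"
proof (cases "coeff F i = 0")
  case False
  define d where "d = degree (coeff F i)"
  have "coeff (map_poly (\<lambda>q. coeff q d) F) i \<noteq> 0"
    using False by (simp add: coeff_map_poly d_def)
  then have "map_poly (\<lambda>q. coeff q d) F \<noteq> 0" by auto
  then have "finite ({l. poly (map_poly (\<lambda>q. coeff q d) F) l = 0} \<union> {l. poly G [:l:] = 0})"
    using assms by (intro finite_UnI poly_roots_finite finite_const_roots)
  from ex_new_if_finite[OF infinite_UNIV_char_0 this]
  obtain l where l: "coeff (poly F [:l:]) d \<noteq> 0" "poly G [:l:] \<noteq> 0"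
    by (auto simp: coeff_poly_const_arg)
  then have "d \<le> degree (poly F [:l:])" by (intro le_degree)
  also have "\<dots> \<le> degree (poly (F * G) [:l:])"
    using l by (subst poly_mult, subst degree_mult_eq) auto
  also have "\<dots> \<le> N" by (intro degree_poly_const_arg_le N)
  finally show ?thesis by (simp add: d_def)
qed simp

lemma monic_factorization:
  fixes F G :: "'a::idom poly"
  assumes "lead_coeff (F * G) = 1"
  obtains F' G' where "F * G = F' * G'" "lead_coeff F' = 1" "lead_coeff G' = 1"
    "degree F' = degree F" "degree G' = degree G"
proof (rule that)
  have *: "lead_coeff F * lead_coeff G = 1" using assms by (simp add: lead_coeff_mult)
  then have nz: "lead_coeff F \<noteq> 0" "lead_coeff G \<noteq> 0" by (metis mult_zero_left mult_zero_right zero_neq_one)+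
  show "F * G = Polynomial.smult (lead_coeff G) F * Polynomial.smult (lead_coeff F) G"
    using * by (simp add: mult.commute)
  show "degree (Polynomial.smult (lead_coeff G) F) = degree F" "degree (Polynomial.smult (lead_coeff F) G) = degree G"
    using nz by (simp_all del: leading_coeff_0_iff)
  show "lead_coeff (Polynomial.smult (lead_coeff G) F) = 1" "lead_coeff (Polynomial.smult (lead_coeff F) G) = 1"
    using nz * by (simp_all add: mult.commute lead_coeff_smult)
qed

text \<open>
  The roots are indexed by an arbitrary finite set, so that the roots of two complementary factors
  can later share one index range.
\<close>

lemma monic_splits:
  fixes p :: "complex poly"
  assumes "finite I" "lead_coeff p = 1" "degree p = card I"
  shows "\<exists>y. p = (\<Prod>i\<in>I. [:- y i, 1:])"
  using assms
proof (induction I arbitrary: p rule: finite_induct)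
  case empty
  then obtain z where "p = [:z:]" using degree0_coeffs[of p] by auto
  then show ?case using empty by simp
next
  case (insert i I)
  then have "\<not> constant (poly p)" by (simp add: constant_degree)
  then obtain x where "poly p x = 0" using fundamental_theorem_of_algebra by blast
  then obtain q where q: "p = [:-x, 1:] * q" unfolding poly_eq_0_iff_dvd by (elim dvdE)
  then have "q \<noteq> 0" using insert.prems by auto
  then have deg: "degree p = Suc (degree q)" unfolding q by (subst degree_mult_eq) auto
  have "lead_coeff p = lead_coeff q" unfolding q by (subst lead_coeff_mult) simp
  then have "lead_coeff q = 1" using insert.prems by simp
  moreover have "degree q = card I" using deg insert.prems insert.hyps by simp
  ultimately obtain y where y: "q = (\<Prod>i\<in>I. [:- y i, 1:])"
    using insert.IH[of q] by blast
  have "(\<Prod>j\<in>I. [:- (y(i := x)) j, 1:]) = (\<Prod>j\<in>I. [:- y j, 1:])"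
    using insert.hyps by (intro prod.cong) auto
  then have "p = (\<Prod>j\<in>insert i I. [:- (y(i := x)) j, 1:])"
    unfolding q y using insert.hyps by simp
  then show ?case by blast
qed

text \<open>
  The nodes are $0,\dots,N$.
\<close>

lemma lagrange_basis:
  obtains L :: "nat \<Rightarrow> complex poly" where
    "\<And>p t. degree p \<le> N \<Longrightarrow> poly p t = (\<Sum>j\<le>N. poly (L j) t * poly p (of_nat j))"
proof -
  define B :: "nat \<Rightarrow> complex poly" where "B j = (\<Prod>l\<in>{..N} - {j}. [:- of_nat l, 1:])" for j
  define L where "L j = Polynomial.smult (inverse (poly (B j) (of_nat j))) (B j)" for j
  have B0: "poly (B j) (of_nat j) \<noteq> 0" for j
    by (auto simp: B_def poly_prod)
  have B1: "poly (B j) (of_nat l) = 0" if "l \<le> N" "l \<noteq> j" for j l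
    using that by (auto simp: B_def poly_prod)
  have "degree (B j) \<le> N" if "j \<le> N" for j
  proof -
    have "degree (B j) = (\<Sum>l\<in>{..N} - {j}. degree [:- of_nat l :: complex, 1:])"
      unfolding B_def by (intro degree_prod_eq_sum_degree) auto
    then show ?thesis using that by simp
  qed
  then have LN: "degree (L j) \<le> N" if "j \<le> N" for j using that unfolding L_def
    by (meson degree_smult_le order_trans)
  have expand: "p = (\<Sum>j\<le>N. Polynomial.smult (poly p (of_nat j)) (L j))" if p: "degree p \<le> N" for p
  proof (rule poly_eqI_degree[of "of_nat ` {..N}"])
    have card: "card (of_nat ` {..N} :: complex set) = Suc N"
      by (subst card_image) (auto intro: inj_onI)
    show "degree p < card (of_nat ` {..N} :: complex set)" using p card by simp
    have "degree (\<Sum>j\<le>N. Polynomial.smult (poly p (of_nat j)) (L j)) \<le> N"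
      by (intro degree_sum_le) (auto intro: LN)
    then show "degree (\<Sum>j\<le>N. Polynomial.smult (poly p (of_nat j)) (L j)) < card (of_nat ` {..N} :: complex set)"
      using card by simp
    fix x :: complex assume "x \<in> of_nat ` {..N}"
    then obtain l where l: "x = of_nat l" "l \<le> N" by auto
    have "poly (\<Sum>j\<le>N. Polynomial.smult (poly p (of_nat j)) (L j)) x
        = (\<Sum>j\<le>N. if j = l then poly p x else 0)"
      unfolding poly_sum using l B0 B1 by (intro sum.cong) (auto simp: L_def)
    then show "poly p x = poly (\<Sum>j\<le>N. Polynomial.smult (poly p (of_nat j)) (L j)) x" using l by simp
  qed
  have "poly p t = (\<Sum>j\<le>N. poly (L j) t * poly p (of_nat j))" if "degree p \<le> N" for p t
    using arg_cong[OF expand[OF that], of "\<lambda>q. poly q t"]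
    by (simp only: poly_sum poly_smult mult.commute)
  then show ?thesis by (rule that)
qed

section \<open>Factorizations of prescribed degrees form a closed condition\<close>

definition splits_into_degrees :: "nat \<Rightarrow> nat \<Rightarrow> complex poly poly \<Rightarrow> bool" where
  "splits_into_degrees k l P \<longleftrightarrow> (\<exists>F G. P = F * G \<and> degree F = k \<and> degree G = l)"

lemma coeff_at_t: "coeff (at_t t F) i = poly (coeff F i) t"
  by (simp add: at_t_def coeff_map_poly)

text \<open>
  For a factorization into monic \<open>F\<close> and \<open>G\<close>, the unknowns are the roots of $F(\tau,\lambda)$ and
  $G(\tau,\lambda)$ at the nodes $\tau=0,\dots,N$. They are roots of $Q_v(\tau,\lambda)$, and \<open>F\<close> and \<open>G\<close>
  are recovered from them by interpolation, since their degree in $t$ is at most \<open>N\<close>. Conversely,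
  any choice of roots of $Q_{v_0}(\tau,\lambda)$ interpolates to two polynomials whose degrees are at
  most \<open>k\<close> and \<open>n - k\<close>; as $Q_{v_0}$ has no such factorization, their product differs from it. There are finitely many
  choices, so a single point $(t_0,\lambda_0)$ witnesses all these differences. The equation that
  compares the product with $Q_v$ at this point is the one from which the unknowns are eliminated.
\<close>

lemma no_splitting_is_open:
  fixes Q :: "(nat \<Rightarrow> complex) \<Rightarrow> complex poly poly"
  assumes "finite V" and "k \<le> n" "n > 0"
    and monic: "\<And>v. lead_coeff (Q v) = 1" and degQ: "\<And>v. degree (Q v) = n"
    and inner: "\<And>v i. degree (coeff (Q v) i) \<le> N"
    and pf: "\<And>i t. (\<lambda>v. poly (coeff (Q v) i) t) \<in> polyfun V"
    and v0: "\<not> splits_into_degrees k (n - k) (Q v0)"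
  shows "\<exists>D\<in>polyfun V. D v0 \<noteq> 0 \<and>
    (\<forall>v. D v \<noteq> 0 \<longrightarrow> \<not> splits_into_degrees k (n - k) (Q v))"
proof -
  obtain K where K: "V \<subseteq> {..<K}"
    using \<open>finite V\<close> by (metis finite_nat_iff_bounded)
  obtain L :: "nat \<Rightarrow> complex poly" where L:
    "\<And>p t. degree p \<le> N \<Longrightarrow> poly p t = (\<Sum>j\<le>N. poly (L j) t * poly p (of_nat j))"
    using lagrange_basis[of N] by blast
  define W where "W = {K..<K + (N + 1) * n}"
  \<comment> \<open>Coordinate of the \<open>i\<close>-th root at the node \<open>j\<close>; indices \<open>i < k\<close> belong to \<open>F\<close>, the others to \<open>G\<close>.\<close>
  define ix where "ix j i = K + (j * n + i)" for j i
  have ixW: "ix j i \<in> W" if "j \<le> N" "i < n" for j i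
  proof -
    have "j * n + i < (j + 1) * n" using that by simp
    also have "\<dots> \<le> (N + 1) * n" using that by (intro mult_right_mono) auto
    finally show ?thesis by (simp add: ix_def W_def)
  qed
  have ix_div: "(ix j i - K) div n = j" "(ix j i - K) mod n = i" if "i < n" for j i
    using that by (simp_all add: ix_def)
  \<comment> \<open>The polynomial whose value at the node \<open>j\<close> has the roots \<open>u (ix j i)\<close> for \<open>i \<in> I\<close>.\<close>
  define B where "B I u = (\<Sum>j\<le>N. Polynomial.smult (L j) (\<Prod>i\<in>I. [:- [:u (ix j i):], 1:]))"
    for I and u :: "nat \<Rightarrow> complex"
  define p where "p w v = at_t (of_nat ((w - K) div n)) (Q v)" for w v
  have VW: "V \<inter> W = {}" using K by (auto simp: W_def)
  have Qcong: "Q u = Q v" if "\<And>i. i \<in> V \<Longrightarrow> u i = v i" for u v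
  proof (rule poly_eqI)
    fix i
    have "poly (coeff (Q u) i) = poly (coeff (Q v) i)"
    proof
      fix t show "poly (coeff (Q u) i) t = poly (coeff (Q v) i) t"
        by (rule polyfun_cong[OF pf]) (rule that)
    qed
    then show "coeff (Q u) i = coeff (Q v) i" by (simp only: poly_eq_poly_eq_iff)
  qed
  have p_monic: "lead_coeff (p w v) = 1" and p_deg: "degree (p w v) = n" for w v
    unfolding p_def using at_t_monic[OF monic[of v]] degQ by auto
  have p_pf: "(\<lambda>v. coeff (p w v) j) \<in> polyfun V" for w j
    unfolding p_def coeff_at_t by (rule pf)
  have evalB: "poly (poly (B I u) [:l:]) t
      = (\<Sum>j\<le>N. poly (L j) t * (\<Prod>i\<in>I. l - u (ix j i)))" for I u l t
    by (simp add: B_def poly_sum poly_prod)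
  have degB: "degree (B I u) \<le> card I" if "finite I" for I u
    unfolding B_def
  proof (intro degree_sum_le finite_atMost)
    fix j
    have "degree (\<Prod>i\<in>I. [:- [:u (ix j i):], 1:]) = (\<Sum>i\<in>I. degree [:- [:u (ix j i):], 1:])"
      by (intro degree_prod_eq_sum_degree) auto
    then have "degree (\<Prod>i\<in>I. [:- [:u (ix j i):], 1:]) = card I" by simp
    then show "degree (Polynomial.smult (L j) (\<Prod>i\<in>I. [:- [:u (ix j i):], 1:])) \<le> card I"
      by (metis degree_smult_le)
  qed
  define E where "E u = B {..<k} u * B {k..<n} u - Q v0" for u
  have E0: "E u \<noteq> 0" for u
  proof
    assume "E u = 0"
    then have eq: "Q v0 = B {..<k} u * B {k..<n} u" by (simp add: E_def)
    have nz: "B {..<k} u \<noteq> 0" "B {k..<n} u \<noteq> 0" using monic[of v0] unfolding eq by auto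
    have "n = degree (B {..<k} u) + degree (B {k..<n} u)"
      using degQ[of v0] nz unfolding eq by (subst (asm) degree_mult_eq) auto
    moreover have "degree (B {..<k} u) \<le> k" "degree (B {k..<n} u) \<le> n - k"
      using degB[of "{..<k}" u] degB[of "{k..<n}" u] by auto
    ultimately have "degree (B {..<k} u) = k" "degree (B {k..<n} u) = n - k"
      using \<open>k \<le> n\<close> by auto
    with eq v0 show False unfolding splits_into_degrees_def by blast
  qed
  define Y where "Y = {u. (\<forall>i. i \<notin> W \<longrightarrow> u i = v0 i) \<and> (\<forall>w\<in>W. poly (p w v0) (u w) = 0)}"
  have "finite Y"
  proof (rule finite_imageD)
    have "p w v0 \<noteq> 0" for w using p_monic[of w v0] by auto
    then have "finite (\<Pi>\<^sub>E w\<in>W. {x. poly (p w v0) x = 0})"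
      by (intro finite_PiE poly_roots_finite) (auto simp: W_def)
    then show "finite ((\<lambda>u. restrict u W) ` Y)"
      by (rule finite_subset[rotated]) (auto simp: Y_def)
    show "inj_on (\<lambda>u. restrict u W) Y"
    proof (rule inj_onI, rule ext)
      fix u u' i assume *: "u \<in> Y" "u' \<in> Y" "restrict u W = restrict u' W"
      show "u i = u' i"
      proof (cases "i \<in> W")
        case True then show ?thesis using fun_cong[OF *(3), of i] by simp
      next
        case False then show ?thesis using * by (simp add: Y_def)
      qed
    qed
  qed
  then have "(\<Prod>u\<in>Y. E u) \<noteq> 0" using E0 by simp
  then obtain l0 t0 where "poly (poly (\<Prod>u\<in>Y. E u) [:l0:]) t0 \<noteq> 0"
    by (rule nonzero_bivariate_value)
  then have EY: "poly (poly (E u) [:l0:]) t0 \<noteq> 0" if "u \<in> Y" for u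
    using that \<open>finite Y\<close> by (auto simp: poly_prod)
  \<comment> \<open>The value at $(t_0,\lambda_0)$ of the interpolated product minus \<open>Q u\<close>, visibly polynomial in \<open>u\<close>.\<close>
  define h where "h u = (\<Sum>j\<le>N. poly (L j) t0 * (\<Prod>i<k. l0 - u (ix j i))) *
      (\<Sum>j\<le>N. poly (L j) t0 * (\<Prod>i=k..<n. l0 - u (ix j i))) -
      (\<Sum>i\<le>n. poly (coeff (Q u) i) t0 * l0 ^ i)" for u
  have evalQ: "(\<Sum>i\<le>n. poly (coeff (Q u) i) t0 * l0 ^ i) = poly (poly (Q u) [:l0:]) t0" for u
    using poly_altdef[of "at_t t0 (Q u)" l0]
    by (simp add: poly_at_t at_t_monic(1)[OF monic] degQ coeff_at_t)
  have h: "h \<in> polyfun (V \<union> W)"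
    unfolding h_def using \<open>k \<le> n\<close> ixW
    by (intro polyfun_diff polyfun.mult polyfun_sum polyfun_prod polyfun.const polyfun.var
        polyfun_mono[OF pf]) auto
  have "finite W" by (simp add: W_def)
  from eliminate_roots[where p = p, OF this VW h p_monic p_deg p_pf]
  obtain D where D: "D \<in> polyfun V" "\<And>v. D v = 0 \<longleftrightarrow>
      (\<exists>u. (\<forall>i. i \<notin> W \<longrightarrow> u i = v i) \<and> (\<forall>w\<in>W. poly (p w v) (u w) = 0) \<and> h u = 0)"
    by metis
  have "D v0 \<noteq> 0"
  proof
    assume "D v0 = 0"
    then obtain u where u: "u \<in> Y" "h u = 0" unfolding D(2) Y_def by blast
    have "Q u = Q v0" using u(1) VW by (intro Qcong) (auto simp: Y_def)
    then have "poly (poly (E u) [:l0:]) t0 = h u"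
      unfolding E_def h_def evalQ by (simp add: evalB)
    with EY[OF u(1)] u(2) show False by simp
  qed
  moreover have "D v = 0" if split: "splits_into_degrees k (n - k) (Q v)" for v
  proof -
    obtain F0 G0 where FG0: "Q v = F0 * G0" "degree F0 = k" "degree G0 = n - k"
      using split unfolding splits_into_degrees_def by blast
    obtain F G where FG: "Q v = F * G" "lead_coeff F = 1" "lead_coeff G = 1"
      "degree F = k" "degree G = n - k"
      using monic_factorization[of F0 G0] monic[of v] FG0 by metis
    have nz: "F \<noteq> 0" "G \<noteq> 0" using FG by auto
    have innerF: "degree (coeff F i) \<le> N" for i
      using inner_degree_factor_le[OF nz] inner[of v] FG(1) by metis
    have innerG: "degree (coeff G i) \<le> N" for i
      using inner_degree_factor_le[OF nz(2,1)] inner[of v] FG(1) by (metis mult.commute)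
    have "\<exists>y. at_t (of_nat j) F = (\<Prod>i<k. [:- y i, 1:])" for j
      using FG by (intro monic_splits at_t_monic(2)) (simp_all add: at_t_monic(1))
    then obtain y where y: "\<And>j. at_t (of_nat j) F = (\<Prod>i<k. [:- y j i, 1:])" by metis
    have "\<exists>z. at_t (of_nat j) G = (\<Prod>i\<in>{k..<n}. [:- z i, 1:])" for j
      using FG by (intro monic_splits at_t_monic(2)) (simp_all add: at_t_monic(1))
    then obtain z where z: "\<And>j. at_t (of_nat j) G = (\<Prod>i\<in>{k..<n}. [:- z j i, 1:])" by metis
    define r where "r j i = (if i < k then y j i else z j i)" for j i
    define u where "u w = (if w \<in> W then r ((w - K) div n) ((w - K) mod n) else v w)" for w
    have u_ix: "u (ix j i) = r j i" if "j \<le> N" "i < n" for j i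
      using ixW[OF that] ix_div[OF that(2)] by (simp add: u_def)
    have Qu: "Q u = Q v" using VW by (intro Qcong) (auto simp: u_def)
    have roots: "poly (p w v) (u w) = 0" if "w \<in> W" for w
    proof -
      define i where "i = (w - K) mod n"
      define j where "j = (w - K) div n"
      have "i < n" using \<open>n > 0\<close> by (simp add: i_def)
      have "p w v = (\<Prod>i<k. [:- y j i, 1:]) * (\<Prod>i\<in>{k..<n}. [:- z j i, 1:])"
        unfolding p_def FG(1) at_t_mult y z j_def ..
      moreover have "u w = r j i" using that by (simp add: u_def i_def j_def)
      ultimately show ?thesis using \<open>i < n\<close>
        by (cases "i < k") (auto simp: r_def poly_prod)
    qed
    have F_t0: "poly (poly F [:l0:]) t0 = (\<Sum>j\<le>N. poly (L j) t0 * (\<Prod>i<k. l0 - u (ix j i)))"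
      (is "_ = ?R")
    proof -
      have "poly (poly F [:l0:]) t0 = (\<Sum>j\<le>N. poly (L j) t0 * poly (at_t (of_nat j) F) l0)"
        unfolding poly_at_t by (rule L[OF degree_poly_const_arg_le[OF innerF]])
      also have "\<dots> = ?R"
        unfolding y using \<open>k \<le> n\<close> by (intro sum.cong refl) (auto simp: poly_prod u_ix r_def)
      finally show ?thesis .
    qed
    have G_t0: "poly (poly G [:l0:]) t0 = (\<Sum>j\<le>N. poly (L j) t0 * (\<Prod>i=k..<n. l0 - u (ix j i)))"
      (is "_ = ?R")
    proof -
      have "poly (poly G [:l0:]) t0 = (\<Sum>j\<le>N. poly (L j) t0 * poly (at_t (of_nat j) G) l0)"
        unfolding poly_at_t by (rule L[OF degree_poly_const_arg_le[OF innerG]])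
      also have "\<dots> = ?R"
        unfolding z by (intro sum.cong refl) (auto simp: poly_prod u_ix r_def)
      finally show ?thesis .
    qed
    have "h u = poly (poly F [:l0:]) t0 * poly (poly G [:l0:]) t0 - poly (poly (Q u) [:l0:]) t0"
      unfolding h_def evalQ F_t0 G_t0 ..
    then have "h u = 0" by (simp add: Qu FG(1))
    then show "D v = 0" unfolding D(2) using roots
      by (intro exI[of _ u]) (auto simp: u_def)
  qed
  ultimately show ?thesis using D(1) by blast
qed

section \<open>Reduced continuants\<close>

text \<open>
  The recursion with the coefficients written out as polynomials in $\lambda$ over $\mathbb{C}[t]$.
\<close>

lemma reduced_continuant_rec:
  "reduced_continuant a c (Suc (Suc k)) =
    [:[:a (Suc (Suc k)):], 1:] * reduced_continuant a c (Suc k)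
      - [:[:0, c (Suc k):]:] * reduced_continuant a c k"
  by (simp add: var_lam_def var_t_def cnst_def)

lemma reduced_continuant_1: "reduced_continuant a c (Suc 0) = [:[:a 1:], 1:]"
  by (simp add: var_lam_def cnst_def)

declare reduced_continuant.simps(2,3) [simp del]

lemma reduced_continuant_cong:
  assumes "\<And>i. i \<in> {1..n} \<Longrightarrow> a i = a' i" "\<And>i. i \<in> {1..<n} \<Longrightarrow> c i = c' i"
  shows "reduced_continuant a c n = reduced_continuant a' c' n"
  using assms
proof (induction a c n rule: reduced_continuant.induct)
  case (3 a c k)
  have "reduced_continuant a c (Suc k) = reduced_continuant a' c' (Suc k)"
    "reduced_continuant a c k = reduced_continuant a' c' k"
    using 3 by auto
  then show ?case using "3.prems" by (simp add: reduced_continuant_rec)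
qed (simp_all add: reduced_continuant_1)

lemma reduced_continuant_monic:
  "degree (reduced_continuant a c n) = n \<and> lead_coeff (reduced_continuant a c n) = 1"
proof (induction a c n rule: reduced_continuant.induct)
  case (3 a c k)
  let ?A = "[:[:a (Suc (Suc k)):], 1:] * reduced_continuant a c (Suc k)"
  let ?B = "[:[:0, c (Suc k):]:] * reduced_continuant a c k"
  have nz: "reduced_continuant a c (Suc k) \<noteq> 0" using 3 by auto
  then have "degree ?A = Suc (Suc k)" using 3 by (subst degree_mult_eq) auto
  moreover have "lead_coeff (reduced_continuant a c (Suc k)) = 1" using 3 by blast
  then have "lead_coeff ?A = 1" by (subst lead_coeff_mult) simp
  ultimately have A: "degree ?A = Suc (Suc k)" "lead_coeff ?A = 1" .
  have B: "degree ?B \<le> k" using 3 degree_mult_le[of "[:[:0, c (Suc k):]:]" "reduced_continuant a c k"] by simp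
  then have deg: "degree (?A - ?B) = degree ?A"
    unfolding diff_conv_add_uminus
    by (intro degree_add_eq_left) (simp only: degree_minus A(1))
  have "coeff ?B (Suc (Suc k)) = 0" using B by (intro coeff_eq_0) simp
  then have "coeff (?A - ?B) (Suc (Suc k)) = 1" using A by (metis coeff_diff diff_zero)
  then show ?case unfolding reduced_continuant_rec deg A(1) by simp
qed (simp_all add: reduced_continuant_1)

lemmas degree_reduced_continuant = reduced_continuant_monic[THEN conjunct1]
lemmas lead_coeff_reduced_continuant = reduced_continuant_monic[THEN conjunct2]

lemma coeff_reduced_continuant_rec:
  "coeff (reduced_continuant a c (Suc (Suc k))) i =
    [:a (Suc (Suc k)):] * coeff (reduced_continuant a c (Suc k)) i
      + (case i of 0 \<Rightarrow> 0 | Suc j \<Rightarrow> coeff (reduced_continuant a c (Suc k)) j)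
      - [:0, c (Suc k):] * coeff (reduced_continuant a c k) i"
  unfolding reduced_continuant_rec by (simp add: coeff_pCons split: nat.split)

lemma inner_degree_reduced_continuant:
  "degree (coeff (reduced_continuant a c n) i) \<le> n"
proof (induction a c n arbitrary: i rule: reduced_continuant.induct)
  case (2 a c)
  then show ?case by (simp add: reduced_continuant_1 coeff_pCons split: nat.split)
next
  case (3 a c k)
  have "degree ([:a (Suc (Suc k)):] * coeff (reduced_continuant a c (Suc k)) i) \<le> Suc (Suc k)"
    using "3.IH"(1)[of i] by (intro order_trans[OF degree_mult_le]) simp
  moreover have "degree (case i of 0 \<Rightarrow> 0 | Suc j \<Rightarrow> coeff (reduced_continuant a c (Suc k)) j) \<le> Suc (Suc k)"
    using "3.IH"(1) by (auto split: nat.split intro: le_SucI)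
  moreover have "degree ([:0, c (Suc k):] * coeff (reduced_continuant a c k) i) \<le> Suc (Suc k)"
    using "3.IH"(2)[of i] by (intro order_trans[OF degree_mult_le]) auto
  ultimately show ?case
    unfolding coeff_reduced_continuant_rec by (intro degree_diff_le degree_add_le)
qed simp

lemma polyfun_reduced_continuant:
  "(\<lambda>c. poly (coeff (reduced_continuant a c n) i) t) \<in> polyfun {1..<n}"
proof (induction n arbitrary: i rule: induct_nat_012)
  case (ge2 k)
  have 1: "(\<lambda>c. poly (coeff (reduced_continuant a c (Suc k)) i) t) \<in> polyfun {1..<Suc (Suc k)}" for i
    by (rule polyfun_mono[OF ge2(2)]) auto
  have 2: "(\<lambda>c. poly (coeff (reduced_continuant a c k) i) t) \<in> polyfun {1..<Suc (Suc k)}" for i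
    by (rule polyfun_mono[OF ge2(1)]) auto
  have 3: "(\<lambda>c. poly (case i of 0 \<Rightarrow> 0 | Suc j \<Rightarrow> coeff (reduced_continuant a c (Suc k)) j) t)
      \<in> polyfun {1..<Suc (Suc k)}"
    using 1 polyfun.const[of 0] by (cases i) simp_all
  have 4: "(\<lambda>c. c (Suc k)) \<in> polyfun {1..<Suc (Suc k)}" by (rule polyfun.var) simp
  have "(\<lambda>c. a (Suc (Suc k)) * poly (coeff (reduced_continuant a c (Suc k)) i) t
      + poly (case i of 0 \<Rightarrow> 0 | Suc j \<Rightarrow> coeff (reduced_continuant a c (Suc k)) j) t
      - t * c (Suc k) * poly (coeff (reduced_continuant a c k) i) t) \<in> polyfun {1..<Suc (Suc k)}"
    by (rule polyfun_diff[OF polyfun.add[OF polyfun.mult[OF polyfun.const 1] 3]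
      polyfun.mult[OF polyfun.mult[OF polyfun.const 4] 2]])
  then show ?case unfolding coeff_reduced_continuant_rec by (simp add: mult.assoc)
qed (simp_all add: reduced_continuant_1 polyfun.const)

lemma nat_cases_two:
  obtains "n = 0" | "n = Suc 0" | k where "n = Suc (Suc k)"
  by (cases n; cases "n - 1") auto

text \<open>
  The continuant is the determinant of a tridiagonal matrix; this is its expansion along the first
  row instead of the last.
\<close>

lemma reduced_continuant_expand_left:
  "reduced_continuant a c (Suc (Suc k)) =
    [:[:a 1:], 1:] * reduced_continuant (\<lambda>i. a (Suc i)) (\<lambda>i. c (Suc i)) (Suc k)
      - [:[:0, c 1:]:] * reduced_continuant (\<lambda>i. a (Suc (Suc i))) (\<lambda>i. c (Suc (Suc i))) k"
proof (induction k rule: less_induct)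
  case (less k)
  define P where "P k = [:[:a k:], 1:]" for k
  define T where "T k = [:[:0, c k:]:]" for k
  define X where "X = reduced_continuant (\<lambda>i. a (Suc i)) (\<lambda>i. c (Suc i))"
  define Y where "Y = reduced_continuant (\<lambda>i. a (Suc (Suc i))) (\<lambda>i. c (Suc (Suc i)))"
  note defs = P_def[symmetric] T_def[symmetric] X_def[symmetric] Y_def[symmetric]
  note rec = reduced_continuant_rec[of a c, folded P_def T_def]
    reduced_continuant_rec[of "\<lambda>i. a (Suc i)" "\<lambda>i. c (Suc i)", folded P_def T_def X_def]
    reduced_continuant_rec[of "\<lambda>i. a (Suc (Suc i))" "\<lambda>i. c (Suc (Suc i))", folded P_def T_def Y_def]
  have init: "reduced_continuant a c 0 = 1" "X 0 = 1" "Y 0 = 1"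
    "reduced_continuant a c (Suc 0) = P 1" "X (Suc 0) = P 2" "Y (Suc 0) = P 3"
    by (simp_all add: X_def Y_def P_def reduced_continuant_1 numeral_2_eq_2 numeral_3_eq_3)
  have "reduced_continuant a c (Suc (Suc k)) = P 1 * X (Suc k) - T 1 * Y k"
  proof -
    consider "k = 0" | "k = Suc 0" | j where "k = Suc (Suc j)" by (rule nat_cases_two)
    then show ?thesis
    proof cases
      case 1
      then show ?thesis by (simp add: rec init mult.commute numeral_2_eq_2)
    next
      case 2
      then show ?thesis
        by (simp add: rec init numeral_2_eq_2 numeral_3_eq_3 right_diff_distrib mult.commute mult.left_commute)
    next
      case 3
      have IH: "reduced_continuant a c (Suc (Suc i)) = P 1 * X (Suc i) - T 1 * Y i" if "i < k" for i
        using less.IH[OF that] by (simp only: defs)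
      have "reduced_continuant a c (Suc (Suc k)) =
          P (Suc (Suc k)) * (P 1 * X (Suc (Suc j)) - T 1 * Y (Suc j))
          - T (Suc k) * (P 1 * X (Suc j) - T 1 * Y j)"
        using IH[of "Suc j"] IH[of j] by (simp add: 3 rec(1)[of "Suc (Suc j)"])
      also have "\<dots> = P 1 * (P (Suc (Suc k)) * X (Suc (Suc j)) - T (Suc k) * X (Suc j))
          - T 1 * (P (Suc (Suc k)) * Y (Suc j) - T (Suc k) * Y j)"
        by (simp only: right_diff_distrib mult.commute mult.left_commute) simp
      also have "\<dots> = P 1 * X (Suc k) - T 1 * Y k"
        unfolding 3 rec(2,3) ..
      finally show ?thesis .
    qed
  qed
  then show ?case by (simp only: P_def T_def X_def Y_def)
qed

text \<open>
  Reversal exchanges the odd and the even entries if \<open>n\<close> is even, and it moves the first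
  entry to the end.
\<close>

lemma reduced_continuant_reverse:
  "reduced_continuant a c n = reduced_continuant (\<lambda>i. a (Suc n - i)) (\<lambda>i. c (n - i)) n"
proof (induction n rule: less_induct)
  case (less n)
  consider "n = 0" | "n = Suc 0" | k where "n = Suc (Suc k)" by (rule nat_cases_two)
  then show ?case
  proof cases
    case 3
    let ?a = "\<lambda>i. a (Suc n - i)" and ?c = "\<lambda>i. c (n - i)"
    have "reduced_continuant ?a ?c n =
      [:[:?a 1:], 1:] * reduced_continuant (\<lambda>i. ?a (Suc i)) (\<lambda>i. ?c (Suc i)) (Suc k)
      - [:[:0, ?c 1:]:] * reduced_continuant (\<lambda>i. ?a (Suc (Suc i))) (\<lambda>i. ?c (Suc (Suc i))) k"
      using reduced_continuant_expand_left[of ?a ?c k] by (simp only: 3)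
    moreover have "reduced_continuant (\<lambda>i. ?a (Suc i)) (\<lambda>i. ?c (Suc i)) (Suc k)
        = reduced_continuant a c (Suc k)"
      using less.IH[of "Suc k"] by (simp add: 3)
    moreover have "reduced_continuant (\<lambda>i. ?a (Suc (Suc i))) (\<lambda>i. ?c (Suc (Suc i))) k
        = reduced_continuant a c k"
      using less.IH[of k] by (simp add: 3)
    ultimately show ?thesis using reduced_continuant_rec[of a c k] by (simp add: 3)
  qed (simp_all add: reduced_continuant_1)
qed

lemma poly_reduced_continuant_rec:
  "poly (reduced_continuant a c (Suc (Suc k))) f =
    ([:a (Suc (Suc k)):] + f) * poly (reduced_continuant a c (Suc k)) f
      - [:0, c (Suc k):] * poly (reduced_continuant a c k) f"
  by (simp add: reduced_continuant_rec distrib_right)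

text \<open>
  Substituting a nonconstant $f(t)$ for $\lambda$ makes the product term of the recursion dominate.
  Consequently a factor of the continuant that is linear in $\lambda$ does not involve $t$.
\<close>

lemma degree_reduced_continuant_at_nonconst:
  assumes "degree f > 0"
  shows "degree (poly (reduced_continuant a c n) f) = n * degree f \<and>
    poly (reduced_continuant a c n) f \<noteq> 0"
proof (induction a c n rule: reduced_continuant.induct)
  case (2 a c)
  have "degree ([:a 1:] + f) = degree f" using assms by (intro degree_add_eq_right) simp
  then show ?case using assms by (auto simp: reduced_continuant_1)
next
  case (3 a c k)
  let ?q = "\<lambda>k. poly (reduced_continuant a c k) f"
  have f: "degree ([:a (Suc (Suc k)):] + f) = degree f" using assms by (intro degree_add_eq_right) simp
  then have "[:a (Suc (Suc k)):] + f \<noteq> 0" using assms by auto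
  then have A: "degree (([:a (Suc (Suc k)):] + f) * ?q (Suc k)) = Suc (Suc k) * degree f"
    using 3 f by (subst degree_mult_eq) auto
  have "degree ([:0, c (Suc k):] * ?q k) \<le> 1 + k * degree f"
    using 3 by (intro order_trans[OF degree_mult_le]) auto
  also have "\<dots> < Suc (Suc k) * degree f" using assms by simp
  finally have "degree (?q (Suc (Suc k))) = Suc (Suc k) * degree f"
    unfolding poly_reduced_continuant_rec diff_conv_add_uminus
    by (subst degree_add_eq_left) (simp_all only: A degree_minus)
  moreover from this have "?q (Suc (Suc k)) \<noteq> 0" using assms by auto
  ultimately show ?case by simp
qed simp

text \<open>
  For constant $\lambda$ the top coefficient in $t$ of a continuant of even size comes from the
  perfect matching, whose weight is a nonzero product of couplings. Hence continuants of even size have no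
  factor $\lambda-z$.
\<close>

lemma degree_reduced_continuant_at_const:
  assumes "\<And>i. c i \<noteq> 0"
  shows "degree (poly (reduced_continuant a c (2 * i)) [:z:]) = i \<and>
    poly (reduced_continuant a c (2 * i)) [:z:] \<noteq> 0 \<and>
    degree (poly (reduced_continuant a c (Suc (2 * i))) [:z:]) \<le> i"
proof (induction i)
  case 0
  then show ?case by (simp add: reduced_continuant_1)
next
  case (Suc i)
  let ?q = "\<lambda>k. poly (reduced_continuant a c k) [:z:]"
  have lin: "degree ([:a k:] + [:z:]) = 0" for k by simp
  have B: "degree ([:0, c (Suc (2 * i)):] * ?q (2 * i)) = Suc i"
    using Suc assms by (subst degree_mult_eq) auto
  have "degree (([:a (Suc (Suc (2 * i))):] + [:z:]) * ?q (Suc (2 * i))) \<le> i"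
    using Suc lin by (intro order_trans[OF degree_mult_le]) simp
  then have even: "degree (?q (Suc (Suc (2 * i)))) = Suc i"
    unfolding poly_reduced_continuant_rec diff_conv_add_uminus
    by (subst degree_add_eq_right) (simp_all only: B degree_minus)
  have "degree (([:a (Suc (Suc (Suc (2 * i)))):] + [:z:]) * ?q (Suc (Suc (2 * i)))) \<le> Suc i"
    using even lin by (intro order_trans[OF degree_mult_le]) simp
  moreover have "degree ([:0, c (Suc (Suc (2 * i))):] * ?q (Suc (2 * i))) \<le> Suc i"
    using Suc by (intro order_trans[OF degree_mult_le]) auto
  ultimately have "degree (?q (Suc (Suc (Suc (2 * i))))) \<le> Suc i"
    unfolding poly_reduced_continuant_rec[of _ _ "Suc (2 * i)"] by (rule degree_diff_le)
  then show ?case using even by auto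
qed

text \<open>
  At $t=0$ the continuant is a product, so a factor $\lambda-z$ has $z=-a_k$ for some \<open>k\<close>.
\<close>

lemma reduced_continuant_at_origin:
  "poly (poly (reduced_continuant a c n) [:z:]) 0 = (\<Prod>k\<in>{1..n}. a k + z)"
proof (induction a c n rule: reduced_continuant.induct)
  case (3 a c k)
  have "{1..Suc (Suc k)} = insert (Suc (Suc k)) {1..Suc k}" by auto
  then show ?case unfolding poly_reduced_continuant_rec using 3 by simp
qed (simp_all add: reduced_continuant_1)

section \<open>Genericity in the torus\<close>

definition monomial_value :: "(nat \<Rightarrow> complex) \<Rightarrow> (nat \<Rightarrow>\<^sub>0 nat) \<Rightarrow> complex" where
  "monomial_value c m = (\<Prod>i\<in>Poly_Mapping.keys m. c i ^ Poly_Mapping.lookup m i)"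

lemma monomial_value_superset:
  assumes "finite S" "Poly_Mapping.keys m \<subseteq> S"
  shows "monomial_value c m = (\<Prod>i\<in>S. c i ^ Poly_Mapping.lookup m i)"
  unfolding monomial_value_def
  using assms by (intro prod.mono_neutral_left) (auto simp: in_keys_iff)

lemma monomial_value_add:
  "monomial_value c (m + m') = monomial_value c m * monomial_value c m'"
proof -
  let ?S = "Poly_Mapping.keys m \<union> Poly_Mapping.keys m'"
  have "finite ?S" "Poly_Mapping.keys (m + m') \<subseteq> ?S" by (simp_all add: keys_add)
  then show ?thesis
    by (simp add: monomial_value_superset[of ?S] lookup_add power_add prod.distrib)
qed

lemma mpoly_eval_superset:
  assumes "finite S" "Poly_Mapping.keys p \<subseteq> S"
  shows "mpoly_eval c p = (\<Sum>m\<in>S. Poly_Mapping.lookup p m * monomial_value c m)"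
  unfolding mpoly_eval_def monomial_value_def[symmetric]
  using assms by (intro sum.mono_neutral_left) (auto simp: in_keys_iff)

lemma mpoly_eval_add: "mpoly_eval c (p + q) = mpoly_eval c p + mpoly_eval c q"
proof -
  let ?S = "Poly_Mapping.keys p \<union> Poly_Mapping.keys q"
  have "finite ?S" "Poly_Mapping.keys (p + q) \<subseteq> ?S" by (simp_all add: keys_add)
  then show ?thesis
    by (simp add: mpoly_eval_superset[of ?S] lookup_add distrib_right sum.distrib)
qed

lemma mpoly_eval_single: "mpoly_eval c (Poly_Mapping.single m x) = x * monomial_value c m"
  by (subst mpoly_eval_superset[of "{m}"]) auto

lemma update_as_sum:
  "m \<notin> Poly_Mapping.keys p \<Longrightarrow> Poly_Mapping.update m x p = p + Poly_Mapping.single m x"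
  by (rule poly_mapping_eqI) (auto simp: lookup_update lookup_add lookup_single in_keys_iff when_def)

text \<open>
  Both factors are built up one monomial at a time.
\<close>

lemma mpoly_eval_mult: "mpoly_eval c (p * q) = mpoly_eval c p * mpoly_eval c q"
proof (induction p rule: update_induct)
  case const
  then show ?case by (simp add: mpoly_eval_def)
next
  case (update p m x)
  have "mpoly_eval c (Poly_Mapping.single m x * q) = mpoly_eval c (Poly_Mapping.single m x) * mpoly_eval c q"
  proof (induction q rule: update_induct)
    case const
    then show ?case by (simp add: mpoly_eval_def)
  next
    case (update q m' y)
    then show ?case
      by (simp add: update_as_sum distrib_left mpoly_eval_add mult_single mpoly_eval_single
        monomial_value_add)
  qed
  then show ?case using update by (simp add: update_as_sum distrib_right mpoly_eval_add)
qed

text \<open>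
  Polynomial functions meet the formal polynomials that define the Zariski topology.
\<close>

lemma polyfun_is_mpoly_eval:
  assumes "f \<in> polyfun {1..k}"
  shows "\<exists>p\<in>mpolys k. \<forall>c. mpoly_eval c p = f c"
  using assms
proof (induction rule: polyfun.induct)
  case (const z)
  show ?case
    by (intro bexI[of _ "Poly_Mapping.single 0 z"])
      (auto simp: mpoly_eval_single monomial_value_def mpolys_def split: if_splits)
next
  case (var i)
  then show ?case
    by (intro bexI[of _ "Poly_Mapping.single (Poly_Mapping.single i 1) 1"])
      (auto simp: mpoly_eval_single monomial_value_def mpolys_def)
next
  case (add f g)
  then obtain p q where "p \<in> mpolys k" "q \<in> mpolys k"
    "\<forall>c. mpoly_eval c p = f c" "\<forall>c. mpoly_eval c q = g c" by blast
  moreover have "p + q \<in> mpolys k" using \<open>p \<in> mpolys k\<close> \<open>q \<in> mpolys k\<close> keys_add[of p q]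
    unfolding mpolys_def by blast
  ultimately show ?case by (intro bexI[of _ "p + q"]) (auto simp: mpoly_eval_add)
next
  case (mult f g)
  then obtain p q where pq: "p \<in> mpolys k" "q \<in> mpolys k"
    "\<forall>c. mpoly_eval c p = f c" "\<forall>c. mpoly_eval c q = g c" by blast
  have "p * q \<in> mpolys k" unfolding mpolys_def
  proof (clarify)
    fix m i assume "m \<in> Poly_Mapping.keys (p * q)" and i: "i \<in> Poly_Mapping.keys m"
    then obtain m1 m2 where "m = m1 + m2" "m1 \<in> Poly_Mapping.keys p" "m2 \<in> Poly_Mapping.keys q"
      using keys_mult[of p q] by blast
    then show "i \<in> {1..k}" using i pq(1,2) keys_add[of m1 m2] unfolding mpolys_def by blast
  qed
  then show ?case using pq by (intro bexI[of _ "p * q"]) (auto simp: mpoly_eval_mult)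
qed

text \<open>
  One polynomial and one witness suffice. The witness is restricted to an extensional function to
  become a point of the torus.
\<close>

lemma for_genericI:
  assumes D: "D \<in> polyfun {1..k}" "D c0 \<noteq> 0" and c0: "\<And>i. c0 i \<noteq> 0"
    and Q: "\<And>c. c \<in> torus k \<Longrightarrow> D c \<noteq> 0 \<Longrightarrow> Q c"
  shows "for_generic k Q"
proof -
  obtain p where p: "p \<in> mpolys k" "\<And>c. mpoly_eval c p = D c"
    using polyfun_is_mpoly_eval[OF D(1)] by blast
  let ?Z = "{c \<in> torus k. mpoly_eval c p = 0}"
  have "zariski_closed_in_torus k ?Z" unfolding zariski_closed_in_torus_def
    using p(1) by (intro exI[of _ "{p}"]) auto
  moreover have "restrict c0 {1..k} \<in> torus k" using c0 unfolding torus_def by auto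
  moreover have "D (restrict c0 {1..k}) = D c0" by (rule polyfun_cong[OF D(1)]) simp
  ultimately have "?Z \<noteq> torus k" using D(2) p(2) by (metis (mono_tags, lifting) mem_Collect_eq)
  with \<open>zariski_closed_in_torus k ?Z\<close> show ?thesis unfolding for_generic_def
    using p(2) Q by (intro exI[of _ ?Z]) auto
qed

text \<open>
  Irreducibility of affine space: on the line through \<open>u\<close> and \<open>w\<close> both functions are nonzero polynomials
  in one parameter, and these have finitely many roots.
\<close>

lemma polyfun_common_nonzero:
  assumes "f \<in> polyfun V" "g \<in> polyfun V" "f u \<noteq> 0" "g w \<noteq> 0"
  obtains x where "f x \<noteq> 0" "g x \<noteq> 0"
proof -
  define l where "l s i = u i + s * (w i - u i)" for s i
  have l: "\<exists>q. \<forall>s. l s i = poly q s" for i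
    by (rule exI[of _ "[:u i, w i - u i:]"]) (simp add: l_def)
  obtain p q where p: "\<And>s. f (l s) = poly p s" and q: "\<And>s. g (l s) = poly q s"
    using polyfun_along_curve[of f V l, OF assms(1) l] polyfun_along_curve[of g V l, OF assms(2) l]
    by blast
  have "l 0 = u" "l 1 = w" by (auto simp: l_def)
  then have "p \<noteq> 0" "q \<noteq> 0" using p[of 0] q[of 1] assms by auto
  then have "finite {s. poly (p * q) s = 0}" by (intro poly_roots_finite) simp
  from ex_new_if_finite[OF infinite_UNIV_char_0 this]
  obtain s where "poly (p * q) s \<noteq> 0" by auto
  then show ?thesis using that[of "l s"] p q by simp
qed

section \<open>Irreducibility as the absence of factorizations by degree\<close>

text \<open>
  For a polynomial that is monic in $\lambda$, every factor of degree zero in $\lambda$ is a unit.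
\<close>

lemma irreducible_iff_no_splitting:
  fixes P :: "complex poly poly"
  assumes "lead_coeff P = 1" "degree P > 0"
  shows "irreducible P \<longleftrightarrow> (\<forall>k\<in>{1..<degree P}. \<not> splits_into_degrees k (degree P - k) P)"
proof
  assume irr: "irreducible P"
  show "\<forall>k\<in>{1..<degree P}. \<not> splits_into_degrees k (degree P - k) P"
  proof (rule ballI, rule notI)
    fix k assume k: "k \<in> {1..<degree P}" and "splits_into_degrees k (degree P - k) P"
    then obtain F G where FG: "P = F * G" "degree F = k" "degree G = degree P - k"
      unfolding splits_into_degrees_def by blast
    from irreducibleD[OF irr FG(1)] have "degree F = 0 \<or> degree G = 0"
      by (auto simp: poly_dvd_1)
    then show False using k FG by auto
  qed
next
  assume ns: "\<forall>k\<in>{1..<degree P}. \<not> splits_into_degrees k (degree P - k) P"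
  show "irreducible P"
  proof (rule irreducibleI)
    show "P \<noteq> 0" using assms by auto
    show "\<not> P dvd 1" using assms by (auto simp: poly_dvd_1)
    fix F G assume P: "P = F * G"
    then have nz: "F \<noteq> 0" "G \<noteq> 0" using assms by auto
    have deg: "degree P = degree F + degree G" unfolding P using nz by (rule degree_mult_eq)
    have lc: "lead_coeff F * lead_coeff G = 1"
      using assms(1) unfolding P lead_coeff_mult .
    then have units: "lead_coeff F dvd 1" "lead_coeff G dvd 1"
      by (metis dvd_triv_left, metis dvd_triv_right)
    have "degree F = 0 \<or> degree G = 0"
      using ns deg P unfolding splits_into_degrees_def by force
    then show "F dvd 1 \<or> G dvd 1"
      using units by (metis poly_dvd_1)
  qed
qed

lemma no_reduced_continuant_splitting_is_open:
  assumes "K \<subseteq> {..n}" "n > 0"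
    and "\<And>k. k \<in> K \<Longrightarrow> \<not> splits_into_degrees k (n - k) (reduced_continuant a c0 n)"
  shows "\<exists>D\<in>polyfun {1..<n}. D c0 \<noteq> 0 \<and> (\<forall>c. D c \<noteq> 0 \<longrightarrow>
    (\<forall>k\<in>K. \<not> splits_into_degrees k (n - k) (reduced_continuant a c n)))"
proof -
  have "finite K" using assms(1) finite_subset by blast
  have "\<exists>D\<in>polyfun {1..<n}. D c0 \<noteq> 0 \<and> (\<forall>c. D c \<noteq> 0 \<longrightarrow>
    \<not> splits_into_degrees k (n - k) (reduced_continuant a c n))" if "k \<in> K" for k
    using that assms
    by (intro no_splitting_is_open[where N = n] lead_coeff_reduced_continuant
      degree_reduced_continuant inner_degree_reduced_continuant polyfun_reduced_continuant) auto
  then obtain D where D: "\<And>k. k \<in> K \<Longrightarrow> D k \<in> polyfun {1..<n}" "\<And>k. k \<in> K \<Longrightarrow> D k c0 \<noteq> 0"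
    "\<And>k c. k \<in> K \<Longrightarrow> D k c \<noteq> 0 \<Longrightarrow> \<not> splits_into_degrees k (n - k) (reduced_continuant a c n)"
    by metis
  then show ?thesis using \<open>finite K\<close>
    by (intro bexI[of _ "\<lambda>v. \<Prod>k\<in>K. D k v"] polyfun_prod) auto
qed

lemma irreducible_reduced_continuant_iff:
  "n > 0 \<Longrightarrow> irreducible (reduced_continuant a c n) \<longleftrightarrow>
    (\<forall>k\<in>{1..<n}. \<not> splits_into_degrees k (n - k) (reduced_continuant a c n))"
  using irreducible_iff_no_splitting[OF lead_coeff_reduced_continuant]
  unfolding degree_reduced_continuant .

lemma irreducible_reduced_continuant_is_open:
  assumes "n > 0" "irreducible (reduced_continuant a c0 n)"
  shows "\<exists>D\<in>polyfun {1..<n}. D c0 \<noteq> 0 \<and>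
    (\<forall>c. D c \<noteq> 0 \<longrightarrow> irreducible (reduced_continuant a c n))"
  using assms(2) unfolding irreducible_reduced_continuant_iff[OF assms(1)]
  by (intro no_reduced_continuant_splitting_is_open assms(1)) auto

section \<open>Reducible continuants\<close>

lemma reducible_reduced_continuant_iff:
  assumes "n > 0"
  shows "reducible (reduced_continuant a c n) \<longleftrightarrow> \<not> irreducible (reduced_continuant a c n)"
proof -
  have "reduced_continuant a c n \<noteq> 0" "\<not> reduced_continuant a c n dvd 1"
    using lead_coeff_reduced_continuant[of a c n] degree_reduced_continuant[of a c n] assms
    by (auto simp: poly_dvd_1)
  then show ?thesis by (simp add: reducible_def)
qed

lemma reducible_if_dvd:
  assumes "F dvd reduced_continuant a c n" "0 < degree F" "degree F < n"
  shows "reducible (reduced_continuant a c n)"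
proof -
  obtain G where G: "reduced_continuant a c n = F * G" using assms(1) by (elim dvdE)
  then have "F \<noteq> 0" "G \<noteq> 0" using lead_coeff_reduced_continuant[of a c n] by auto
  then have "n = degree F + degree G"
    using degree_reduced_continuant[of a c n] G by (simp add: degree_mult_eq)
  then have "splits_into_degrees (degree F) (n - degree F) (reduced_continuant a c n)"
    using G unfolding splits_into_degrees_def by auto
  then show ?thesis using assms
    by (subst reducible_reduced_continuant_iff, simp, subst irreducible_reduced_continuant_iff) auto
qed

text \<open>
  At $\lambda=-z$ the recursion reduces to $P_{k+2}=-t\,c_{k+1}P_k$ for odd \<open>k\<close>, and $P_1=0$.
\<close>

lemma reducible_if_odd_entries_equal:
  assumes "m > 0" "\<And>i. i \<le> m \<Longrightarrow> a (2 * i + 1) = z"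
  shows "reducible (reduced_continuant a c (2 * m + 1))"
proof -
  have "poly (reduced_continuant a c (Suc (2 * m))) [:- z:] = 0"
    using assms(2)
  proof (induction m)
    case 0
    then show ?case by (simp add: reduced_continuant_1)
  next
    case (Suc m)
    have "a (Suc (Suc (Suc (2 * m)))) = z" using Suc.prems[of "Suc m"] by simp
    then show ?case
      using Suc.IH Suc.prems poly_reduced_continuant_rec[of a c "Suc (2 * m)" "[:- z:]"] by simp
  qed
  then have "[:- [:- z:], 1:] dvd reduced_continuant a c (2 * m + 1)"
    by (simp add: poly_eq_0_iff_dvd)
  then show ?thesis by (rule reducible_if_dvd) (use assms(1) in auto)
qed

text \<open>
  The binary form of degree \<open>i\<close> in \<open>u\<close> and $t$ that dehomogenizes to \<open>p\<close> for $t=1$.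
\<close>

definition homogenize :: "complex poly poly \<Rightarrow> nat \<Rightarrow> complex poly \<Rightarrow> complex poly poly" where
  "homogenize u i p = (\<Sum>j\<le>i. cnst (coeff p j) * u ^ j * var_t ^ (i - j))"

lemma homogenize_diff: "homogenize u i (p - q) = homogenize u i p - homogenize u i q"
proof -
  have "cnst (x - y) = cnst x - cnst y" for x y by (simp add: cnst_def)
  then show ?thesis by (simp add: homogenize_def left_diff_distrib sum_subtractf)
qed

lemma homogenize_smult: "homogenize u i (Polynomial.smult x p) = cnst x * homogenize u i p"
proof -
  have "cnst (x * y) = cnst x * cnst y" for x y by (simp add: cnst_def)
  then show ?thesis by (simp add: homogenize_def sum_distrib_left mult.assoc)
qed

lemma homogenize_pCons: "homogenize u (Suc i) (pCons 0 p) = u * homogenize u i p"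
  unfolding homogenize_def sum.atMost_Suc_shift
  by (simp add: sum_distrib_left cnst_def mult_ac)

lemma homogenize_Suc:
  assumes "degree p \<le> i"
  shows "homogenize u (Suc i) p = var_t * homogenize u i p"
proof -
  have "(\<Sum>j\<le>i. cnst (coeff p j) * u ^ j * var_t ^ (Suc i - j))
      = (\<Sum>j\<le>i. var_t * (cnst (coeff p j) * u ^ j * var_t ^ (i - j)))"
    by (intro sum.cong) (auto simp: Suc_diff_le mult_ac)
  then show ?thesis using assms
    by (simp add: homogenize_def sum_distrib_left coeff_eq_0 cnst_def)
qed

text \<open>
  The two-term recursion stays within binary forms if continuants of odd size are divided by
  $\lambda+y$. The equation for \<open>2 * m + 1\<close> is conditional because it concerns one entry more than the
  equation for \<open>2 * m\<close>.
\<close>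

lemma reduced_continuant_alternating:
  assumes "\<And>i. i < m \<Longrightarrow> a (2 * i + 1) = y" "\<And>i. i < m \<Longrightarrow> a (2 * i + 2) = z"
  shows "\<exists>p q. degree p \<le> m \<and> degree q \<le> m \<and>
    reduced_continuant a c (2 * m) = homogenize ([:[:y:], 1:] * [:[:z:], 1:]) m p \<and>
    (a (2 * m + 1) = y \<longrightarrow> reduced_continuant a c (2 * m + 1)
      = [:[:y:], 1:] * homogenize ([:[:y:], 1:] * [:[:z:], 1:]) m q)"
  using assms
proof (induction m)
  case 0
  show ?case
    by (intro exI[of _ 1]) (simp add: homogenize_def cnst_def reduced_continuant_1)
next
  case (Suc m)
  let ?u = "[:[:y:], 1:] * [:[:z:], 1:]"
  have "a (2 * m + 1) = y" using Suc.prems(1)[of m] by simp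
  moreover have "\<exists>p q. degree p \<le> m \<and> degree q \<le> m \<and>
      reduced_continuant a c (2 * m) = homogenize ?u m p \<and>
      (a (2 * m + 1) = y \<longrightarrow> reduced_continuant a c (2 * m + 1) = [:[:y:], 1:] * homogenize ?u m q)"
    by (rule Suc.IH) (rule Suc.prems; simp)+
  ultimately obtain p q where pq: "degree p \<le> m" "degree q \<le> m"
    "reduced_continuant a c (2 * m) = homogenize ?u m p"
    "reduced_continuant a c (2 * m + 1) = [:[:y:], 1:] * homogenize ?u m q"
    by blast
  define p' where "p' = pCons 0 q - Polynomial.smult (c (2 * m + 1)) p"
  define q' where "q' = p' - Polynomial.smult (c (2 * m + 2)) q"
  have tc: "[:[:0, x:]:] = var_t * cnst x" for x by (simp add: var_t_def cnst_def)
  have "degree (pCons 0 q) \<le> Suc m" using degree_pCons_le[of 0 q] pq(2) by linarith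
  moreover have "degree (Polynomial.smult (c (2 * m + 1)) p) \<le> Suc m"
    using degree_smult_le[of "c (2 * m + 1)" p] pq(1) by linarith
  ultimately have p': "degree p' \<le> Suc m" unfolding p'_def by (rule degree_diff_le)
  have "degree (Polynomial.smult (c (2 * m + 2)) q) \<le> Suc m"
    using degree_smult_le[of "c (2 * m + 2)" q] pq(2) by linarith
  then have q': "degree q' \<le> Suc m" unfolding q'_def by (rule degree_diff_le[OF p'])
  have "a (Suc (Suc (2 * m))) = z" using Suc.prems(2)[of m] by simp
  then have "reduced_continuant a c (Suc (Suc (2 * m))) =
      [:[:z:], 1:] * ([:[:y:], 1:] * homogenize ?u m q)
      - var_t * cnst (c (2 * m + 1)) * homogenize ?u m p"
    using reduced_continuant_rec[of a c "2 * m"] pq(3,4) by (simp only: tc Suc_eq_plus1)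
  also have "\<dots> = homogenize ?u (Suc m) p'"
    unfolding p'_def homogenize_diff homogenize_smult homogenize_pCons homogenize_Suc[OF pq(1)]
    by (simp only: mult_ac)
  finally have P: "reduced_continuant a c (Suc (Suc (2 * m))) = homogenize ?u (Suc m) p'" .
  have "reduced_continuant a c (Suc (Suc (Suc (2 * m)))) = [:[:y:], 1:] * homogenize ?u (Suc m) q'"
    if "a (Suc (Suc (Suc (2 * m)))) = y"
  proof -
    have "reduced_continuant a c (Suc (Suc (Suc (2 * m)))) =
      [:[:y:], 1:] * homogenize ?u (Suc m) p'
      - var_t * cnst (c (Suc (Suc (2 * m)))) * ([:[:y:], 1:] * homogenize ?u m q)"
      using reduced_continuant_rec[of a c "Suc (2 * m)"] pq(4) that by (simp only: tc P Suc_eq_plus1[symmetric])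
    also have "\<dots> = [:[:y:], 1:] * homogenize ?u (Suc m) q'"
      unfolding q'_def homogenize_diff homogenize_smult homogenize_Suc[OF pq(2)] right_diff_distrib
      by (simp only: mult_ac add_2_eq_Suc')
    finally show ?thesis .
  qed
  then show ?case using P p' q' by (intro exI[of _ p'] exI[of _ q']) simp
qed

text \<open>
  A root \<open>r\<close> of the dehomogenized form yields the factor $u-rt$, of degree two in $\lambda$. The form is
  not a multiple of $t^m$, since the continuant is monic in $\lambda$.
\<close>

lemma reducible_if_entries_alternate:
  assumes "m \<ge> 2" "\<And>i. i < m \<Longrightarrow> a (2 * i + 1) = y" "\<And>i. i < m \<Longrightarrow> a (2 * i + 2) = z"
  shows "reducible (reduced_continuant a c (2 * m))"
proof -
  let ?u = "[:[:y:], 1:] * [:[:z:], 1:]"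
  obtain p where p: "degree p \<le> m" "reduced_continuant a c (2 * m) = homogenize ?u m p"
    using reduced_continuant_alternating[of m a y z c] assms(2,3) by blast
  have "degree p \<noteq> 0"
  proof
    assume "degree p = 0"
    then obtain x where "p = [:x:]" by (rule degree_eq_zeroE)
    then have "homogenize ?u m p = (\<Sum>j\<le>m. if j = 0 then cnst x * var_t ^ m else 0)"
      unfolding homogenize_def by (intro sum.cong) (auto simp: coeff_pCons cnst_def split: nat.splits)
    then have "homogenize ?u m p = cnst x * var_t ^ m" by simp
    also have "\<dots> = [:[:x:] * [:0, 1:] ^ m:]" by (simp add: cnst_def var_t_def poly_const_pow)
    finally have "degree (homogenize ?u m p) = 0" by simp
    then show False using p(2) degree_reduced_continuant[of a c "2 * m"] assms(1) by simp
  qed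
  then have "\<not> constant (poly p)" by (simp add: constant_degree)
  then obtain r where "poly p r = 0" using fundamental_theorem_of_algebra by blast
  then obtain g where g: "p = [:- r, 1:] * g" unfolding poly_eq_0_iff_dvd by (elim dvdE)
  obtain k where k: "m = Suc k" using assms(1) by (cases m) auto
  have "g \<noteq> 0" using g \<open>degree p \<noteq> 0\<close> by auto
  then have "degree p = Suc (degree g)" unfolding g by (subst degree_mult_eq) auto
  then have "degree g \<le> k" using p(1) k by simp
  have "p = pCons 0 g - Polynomial.smult r g" unfolding g by simp
  then have "homogenize ?u m p = (?u - cnst r * var_t) * homogenize ?u k g"
    unfolding k using \<open>degree g \<le> k\<close>
    by (simp only: homogenize_diff homogenize_smult homogenize_pCons homogenize_Suc
      left_diff_distrib mult.assoc)
  then have "?u - cnst r * var_t dvd reduced_continuant a c (2 * m)" using p(2) by simp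
  moreover have "degree (?u - cnst r * var_t) = 2"
    by (simp add: cnst_def var_t_def)
  ultimately show ?thesis by (rule_tac reducible_if_dvd) (use assms(1) in auto)
qed

section \<open>Coupling vectors with an irreducible continuant\<close>

text \<open>
  Nonvanishing is required at all indices, which spares index ranges.
\<close>

definition has_irreducible_coupling :: "(nat \<Rightarrow> complex) \<Rightarrow> nat \<Rightarrow> bool" where
  "has_irreducible_coupling a n \<longleftrightarrow> (\<exists>c. (\<forall>i. c i \<noteq> 0) \<and> irreducible (reduced_continuant a c n))"

text \<open>
  A linear factor is $\lambda-f(t)$; growth in $t$ forces \<open>f\<close> to be constant, and the value at $t=0$ then
  identifies the constant.
\<close>

lemma linear_factor_root:
  assumes "splits_into_degrees 1 (n - 1) (reduced_continuant a c n)"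
  shows "\<exists>k\<in>{1..n}. poly (reduced_continuant a c n) [:- a k:] = 0"
proof -
  obtain F0 G0 where "reduced_continuant a c n = F0 * G0" "degree F0 = 1" "degree G0 = n - 1"
    using assms unfolding splits_into_degrees_def by blast
  then obtain F G where FG: "reduced_continuant a c n = F * G" "lead_coeff F = 1" "degree F = 1"
    using monic_factorization[of F0 G0] lead_coeff_reduced_continuant[of a c n] by metis
  obtain b g where Fg: "F = [:g, b:]" by (rule degree1_coeffs[OF FG(3)])
  then have "b = 1" using FG(2,3) by simp
  with Fg obtain f where F: "F = [:- f, 1:]" using minus_minus[of g] by metis
  have root: "poly (reduced_continuant a c n) f = 0" unfolding FG(1) F by simp
  then have "degree f = 0" using degree_reduced_continuant_at_nonconst[of f a c n] by auto
  then obtain z where z: "f = [:z:]" by (rule degree_eq_zeroE)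
  have "(\<Prod>k\<in>{1..n}. a k + z) = 0"
    using reduced_continuant_at_origin[of a c n z] root by (simp add: z)
  then obtain k where "k \<in> {1..n}" "z = - a k" by (auto simp: eq_neg_iff_add_eq_0 add.commute)
  with root show ?thesis by (auto simp: z)
qed

lemma splits_into_degrees_commute: "splits_into_degrees k l P \<longleftrightarrow> splits_into_degrees l k P"
  unfolding splits_into_degrees_def by (metis mult.commute)

text \<open>
  Irreducible polynomials over the factorial ring $\mathbb{C}[t]$ are prime.
\<close>

lemma irreducible_factor_fits_into_splitting:
  fixes P :: "complex poly poly"
  assumes "irreducible P" "splits_into_degrees k l (L * P)" "L * P \<noteq> 0"
  shows "k \<ge> degree P \<or> l \<ge> degree P"
proof -
  obtain F G where FG: "L * P = F * G" "degree F = k" "degree G = l"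
    using assms(2) unfolding splits_into_degrees_def by blast
  have "prime_elem P" using assms(1) by (rule irreducible_imp_prime_elem)
  moreover have "P dvd F * G" unfolding FG(1)[symmetric] by simp
  ultimately have "P dvd F \<or> P dvd G" by (simp add: prime_elem_dvd_mult_iff)
  moreover have "F \<noteq> 0" "G \<noteq> 0" using assms(3) FG(1) by auto
  ultimately show ?thesis using FG dvd_imp_degree_le by blast
qed

text \<open>
  The last coupling \<open>s\<close> is moved away from zero, where the continuant is $(\lambda+a_{n+1})P_n$.
  Unless both coefficients of an expression that is affine in \<open>s\<close> vanish, it has at most one root;
  this bounds the \<open>s\<close> for which $\lambda+a_i$ is a factor. The assumption \<open>no_root\<close> excludes
  that $\lambda+a_{n+1}$ divides both $P_{n-1}$ and, for every \<open>s\<close>, the continuant of size $n+1$.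
\<close>

lemma irreducible_coupling_extend:
  assumes "n > 0" and c: "\<And>i. c i \<noteq> 0" and irr: "irreducible (reduced_continuant a c n)"
    and no_root: "even n \<Longrightarrow> poly (reduced_continuant a c (n - 1)) [:- a (Suc n):] \<noteq> 0"
  shows "has_irreducible_coupling a (Suc n)"
proof -
  define P where "P s = reduced_continuant a (c(n := s)) (Suc n)" for s
  obtain k where k: "n = Suc k" using \<open>n > 0\<close> gr0_implies_Suc by blast
  have "reduced_continuant a (c(n := s)) n = reduced_continuant a c n"
    "reduced_continuant a (c(n := s)) k = reduced_continuant a c k" for s
    by (rule reduced_continuant_cong; simp add: k)+
  then have P: "P s = [:[:a (Suc n):], 1:] * reduced_continuant a c n
      - [:[:0, s:]:] * reduced_continuant a c (n - 1)" for s
    using reduced_continuant_rec[of a "c(n := s)" k] by (simp add: P_def k)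
  have "\<not> splits_into_degrees j (Suc n - j) (P 0)" if "j \<in> {2..<n}" for j
  proof
    assume *: "splits_into_degrees j (Suc n - j) (P 0)"
    have "P 0 \<noteq> 0"
      using lead_coeff_reduced_continuant[of a "c(n := 0)" "Suc n"] unfolding P_def by auto
    moreover have "P 0 = [:[:a (Suc n):], 1:] * reduced_continuant a c n" unfolding P by simp
    ultimately have "j \<ge> n \<or> Suc n - j \<ge> n"
      using irreducible_factor_fits_into_splitting[OF irr] * degree_reduced_continuant by metis
    then show False using that by auto
  qed
  then have "\<exists>D\<in>polyfun {1..<Suc n}. D (c(n := 0)) \<noteq> 0 \<and> (\<forall>c'. D c' \<noteq> 0 \<longrightarrow>
      (\<forall>j\<in>{2..<n}. \<not> splits_into_degrees j (Suc n - j) (reduced_continuant a c' (Suc n))))"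
    unfolding P_def by (intro no_reduced_continuant_splitting_is_open) auto
  then obtain D where D: "D \<in> polyfun {1..<Suc n}" "D (c(n := 0)) \<noteq> 0"
    "\<And>s j. D (c(n := s)) \<noteq> 0 \<Longrightarrow> j \<in> {2..<n} \<Longrightarrow> \<not> splits_into_degrees j (Suc n - j) (P s)"
    unfolding P_def by blast
  have "\<exists>q. \<forall>s. (c(n := s)) i = poly q s" for i
    by (cases "i = n") (auto intro: exI[of _ "[:0, 1:]"] exI[of _ "[:c i:]"])
  then obtain q where q: "\<And>s. D (c(n := s)) = poly q s"
    using polyfun_along_curve[OF D(1), of "\<lambda>s. c(n := s)"] by blast
  have "q \<noteq> 0" using q[of 0] D(2) by auto
  then have fin1: "finite {s. poly q s = 0}" by (rule poly_roots_finite)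
  have fin2: "finite {s. poly (P s) [:- a i:] = 0 \<and> s \<noteq> 0}" for i
  proof (cases "even n")
    case True
    let ?q = "\<lambda>k. poly (reduced_continuant a c k) [:- a i:]"
    have eval: "poly (P s) [:- a i:] = [:a (Suc n) - a i:] * ?q n - [:0, s:] * ?q (n - 1)" for s
      by (simp add: P smult_diff_left)
    have unique: "s1 = s2" if "poly (P s1) [:- a i:] = 0" "poly (P s2) [:- a i:] = 0" for s1 s2
    proof (rule ccontr)
      assume "s1 \<noteq> s2"
      have "[:0, s1:] * ?q (n - 1) = [:0, s2:] * ?q (n - 1)"
        using that unfolding eval right_minus_eq by (rule trans[OF sym])
      with \<open>s1 \<noteq> s2\<close> have q0: "?q (n - 1) = 0" unfolding mult_cancel_right by simp
      then have "[:a (Suc n) - a i:] * ?q n = 0" using that(1) unfolding eval by simp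
      moreover have "?q n \<noteq> 0"
        using True degree_reduced_continuant_at_const[where c = c and a = a and i = "n div 2" and z = "- a i"] c
        by simp
      ultimately have "[:a (Suc n) - a i:] = 0" unfolding mult_eq_0_iff by blast
      then have "a (Suc n) = a i" by simp
      with q0 no_root[OF True] show False by simp
    qed
    show ?thesis
    proof (cases "\<exists>s1. poly (P s1) [:- a i:] = 0 \<and> s1 \<noteq> 0")
      case True
      then obtain s1 where "poly (P s1) [:- a i:] = 0" by blast
      with unique have "{s. poly (P s) [:- a i:] = 0 \<and> s \<noteq> 0} \<subseteq> {s1}" by blast
      then show ?thesis by (rule finite_subset) simp
    next
      case False
      then have "{s. poly (P s) [:- a i:] = 0 \<and> s \<noteq> 0} = {}" by blast
      then show ?thesis by (simp only: finite.emptyI)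
    qed
  next
    case False
    have "poly (P s) [:- a i:] \<noteq> 0" if "s \<noteq> 0" for s
      using degree_reduced_continuant_at_const[where c = "c(n := s)" and a = a and i = "Suc n div 2"
          and z = "- a i"] c that False
      by (simp add: P_def)
    then have "{s. poly (P s) [:- a i:] = 0 \<and> s \<noteq> 0} = {}" by blast
    then show ?thesis by (simp only: finite.emptyI)
  qed
  have "finite ({s. poly q s = 0} \<union> {0} \<union> (\<Union>i\<in>{1..Suc n}. {s. poly (P s) [:- a i:] = 0 \<and> s \<noteq> 0}))"
    using fin1 fin2 by simp
  from ex_new_if_finite[OF infinite_UNIV_char_0 this]
  obtain s where s: "poly q s \<noteq> 0" "s \<noteq> 0" "\<And>i. i \<in> {1..Suc n} \<Longrightarrow> poly (P s) [:- a i:] \<noteq> 0"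
    by blast
  have no_linear: "\<not> splits_into_degrees 1 n (P s)"
    using linear_factor_root[of "Suc n" a "c(n := s)"] s(3) unfolding P_def by auto
  have "\<not> splits_into_degrees j (Suc n - j) (P s)" if j: "j \<in> {1..<Suc n}" for j
  proof -
    consider "j = 1" | "j = n" | "j \<in> {2..<n}" using j by fastforce
    then show ?thesis
    proof cases
      case 2
      then show ?thesis using no_linear splits_into_degrees_commute[of 1 n] by simp
    next
      case 3
      then show ?thesis using D(3)[of s j] s(1) q by simp
    qed (use no_linear in simp)
  qed
  then have "irreducible (P s)" unfolding P_def by (subst irreducible_reduced_continuant_iff) auto
  moreover have "\<forall>i. (c(n := s)) i \<noteq> 0" using c s(2) by simp
  ultimately show ?thesis unfolding has_irreducible_coupling_def P_def by blast
qed

lemma irreducible_coupling_reverse: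
  assumes "has_irreducible_coupling (\<lambda>i. a (Suc n - i)) n"
  shows "has_irreducible_coupling a n"
proof -
  obtain c where c: "\<And>i. c i \<noteq> 0" "irreducible (reduced_continuant (\<lambda>i. a (Suc n - i)) c n)"
    using assms unfolding has_irreducible_coupling_def by blast
  have "reduced_continuant (\<lambda>i. a (Suc n - i)) c n =
      reduced_continuant (\<lambda>i. a (Suc n - (Suc n - i))) (\<lambda>i. c (n - i)) n"
    by (rule reduced_continuant_reverse)
  also have "\<dots> = reduced_continuant a (\<lambda>i. c (n - i)) n"
    by (rule reduced_continuant_cong) auto
  finally show ?thesis using c unfolding has_irreducible_coupling_def by (intro exI[of _ "\<lambda>i. c (n - i)"]) auto
qed

text \<open>
  The value at $\lambda=-z$ is affine in the last coupling, so if it vanished for all couplings, both of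
  its terms would. Since continuants of even size do not vanish there, the last entry would equal \<open>z\<close>, and
  the continuant of size two less would vanish as well.
\<close>

lemma odd_reduced_continuant_nonzero_at:
  assumes "\<exists>i\<le>m. a (2 * i + 1) \<noteq> z"
  shows "\<exists>c. (\<forall>i. c i \<noteq> 0) \<and> poly (reduced_continuant a c (2 * m + 1)) [:- z:] \<noteq> 0"
  using assms
proof (induction m)
  case 0
  then show ?case by (intro exI[of _ "\<lambda>_. 1"]) (simp add: reduced_continuant_1)
next
  case (Suc m)
  show ?case
  proof (rule ccontr)
    assume none: "\<not> ?thesis"
    define N where "N = Suc (2 * m)"
    let ?q = "\<lambda>c k. poly (reduced_continuant a c k) [:- z:]"
    have zero: "[:a (Suc (Suc N)) - z:] * ?q c (Suc N) = [:0, c (Suc N):] * ?q c N" if "\<forall>i. c i \<noteq> 0" for c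
    proof -
      have "\<not> ((\<forall>i. c i \<noteq> 0) \<and> ?q c (2 * Suc m + 1) \<noteq> 0)" using none by blast
      then have "?q c (Suc (Suc N)) = 0" using that by (simp add: N_def)
      then show ?thesis unfolding poly_reduced_continuant_rec by simp
    qed
    have low: "?q c N = 0" if c: "\<forall>i. c i \<noteq> 0" for c
    proof -
      let ?c = "\<lambda>x. c(Suc N := x)"
      have same: "reduced_continuant a (?c x) (Suc N) = reduced_continuant a c (Suc N)"
        "reduced_continuant a (?c x) N = reduced_continuant a c N" for x
        by (rule reduced_continuant_cong; simp)+
      have "[:a (Suc (Suc N)) - z:] * ?q c (Suc N) = [:0, x:] * ?q c N" if "x \<noteq> 0" for x
        using zero[of "?c x"] c that unfolding same by simp
      \<comment> \<open>Two different values of the last coupling separate the two terms.\<close>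
      from this[of 1] this[of 2] have "[:0, 1:] * ?q c N = [:0, 2:] * ?q c N"
        using trans[OF sym] by (metis one_neq_zero zero_neq_numeral)
      then show "?q c N = 0" unfolding mult_cancel_right by simp
    qed
    have "a (Suc (Suc N)) = z"
    proof -
      have "?q (\<lambda>_. 1) (Suc N) \<noteq> 0"
        using degree_reduced_continuant_at_const[where c = "\<lambda>_. 1" and a = a and i = "Suc m" and z = "- z"]
        by (simp add: N_def)
      moreover have "[:a (Suc (Suc N)) - z:] * ?q (\<lambda>_. 1) (Suc N) = 0"
        using zero[of "\<lambda>_. 1"] low[of "\<lambda>_. 1"] by simp
      ultimately have "[:a (Suc (Suc N)) - z:] = 0" unfolding mult_eq_0_iff by blast
      then show ?thesis by simp
    qed
    moreover obtain i where "i \<le> Suc m" "a (2 * i + 1) \<noteq> z" using Suc.prems by blast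
    ultimately have "i \<le> m" by (cases "i = Suc m") (auto simp: N_def)
    then have "\<exists>c. (\<forall>i. c i \<noteq> 0) \<and> ?q c N \<noteq> 0"
      using Suc.IH \<open>a (2 * i + 1) \<noteq> z\<close> by (auto simp: N_def)
    then show False using low by blast
  qed
qed

text \<open>
  Irreducibility of the shorter continuant and the condition \<open>no_root\<close> of
  \<open>irreducible_coupling_extend\<close> are known for different couplings only. Both are open conditions, so
  they hold simultaneously somewhere.
\<close>

lemma irreducible_coupling_extend_odd:
  assumes "has_irreducible_coupling a (2 * m + 2)" "\<exists>i\<le>m. a (2 * i + 1) \<noteq> a (2 * m + 3)"
  shows "has_irreducible_coupling a (2 * m + 3)"
proof -
  define n where "n = 2 * m + 2"
  obtain c1 where c1: "\<And>i. c1 i \<noteq> 0" "irreducible (reduced_continuant a c1 n)"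
    using assms(1) unfolding has_irreducible_coupling_def n_def by blast
  obtain c2 where "poly (reduced_continuant a c2 (n - 1)) [:- a (Suc n):] \<noteq> 0"
    using odd_reduced_continuant_nonzero_at[OF assms(2)] by (auto simp: n_def numeral_3_eq_3)
  then have "poly (poly (reduced_continuant a c2 (n - 1)) [:- a (Suc n):]) \<noteq> poly 0"
    by (simp only: poly_eq_poly_eq_iff) simp
  then obtain t where t: "poly (poly (reduced_continuant a c2 (n - 1)) [:- a (Suc n):]) t \<noteq> 0"
    by force
  obtain D where D: "D \<in> polyfun {1..<n}" "D c1 \<noteq> 0"
    "\<And>c. D c \<noteq> 0 \<Longrightarrow> irreducible (reduced_continuant a c n)"
    using irreducible_reduced_continuant_is_open[of n a c1] c1(2) by (auto simp: n_def)
  \<comment> \<open>The product over the coordinates keeps the common point off the coordinate hyperplanes.\<close>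
  define f where "f c = D c * (\<Prod>i\<in>{1..<n}. c i)" for c
  define g where "g c = (\<Sum>i\<le>n - 1. poly (coeff (reduced_continuant a c (n - 1)) i) t * (- a (Suc n)) ^ i)" for c
  have g: "g c = poly (poly (reduced_continuant a c (n - 1)) [:- a (Suc n):]) t" for c
    using poly_altdef[of "at_t t (reduced_continuant a c (n - 1))" "- a (Suc n)"]
      at_t_monic(1)[OF lead_coeff_reduced_continuant]
    by (simp add: g_def poly_at_t coeff_at_t degree_reduced_continuant)
  have "f \<in> polyfun {1..<n}" unfolding f_def
    by (intro polyfun.mult D(1) polyfun_prod polyfun.var)
  moreover have "g \<in> polyfun {1..<n}" unfolding g_def
    by (intro polyfun_sum polyfun.mult polyfun.const polyfun_mono[OF polyfun_reduced_continuant]) auto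
  moreover have "f c1 \<noteq> 0" using D(2) c1(1) by (simp add: f_def)
  moreover have "g c2 \<noteq> 0" using t by (simp only: g) simp
  ultimately obtain c0 where c0: "f c0 \<noteq> 0" "g c0 \<noteq> 0" by (rule polyfun_common_nonzero)
  define c where "c i = (if i \<in> {1..<n} then c0 i else 1)" for i
  have agree: "c i = c0 i" if "i \<in> {1..<n}" for i using that by (simp add: c_def)
  have "c i \<noteq> 0" for i using c0(1) by (simp add: c_def f_def)
  moreover have "irreducible (reduced_continuant a c n)"
  proof -
    have "D c = D c0" by (rule polyfun_cong[OF D(1) agree])
    then show ?thesis using c0(1) D(3)[of c] by (simp add: f_def)
  qed
  moreover have "poly (reduced_continuant a c (n - 1)) [:- a (Suc n):] \<noteq> 0"
  proof -
    have "g c = g c0" by (rule polyfun_cong[OF \<open>g \<in> polyfun {1..<n}\<close> agree])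
    then show ?thesis using c0(2) unfolding g by auto
  qed
  ultimately have "has_irreducible_coupling a (Suc n)"
    by (intro irreducible_coupling_extend[of n c a]) (auto simp: n_def)
  then show ?thesis by (simp add: n_def numeral_3_eq_3)
qed

lemma irreducible_coupling_extend_even:
  assumes "has_irreducible_coupling a (2 * m + 1)"
  shows "has_irreducible_coupling a (2 * m + 2)"
proof -
  obtain c where "\<And>i. c i \<noteq> 0" "irreducible (reduced_continuant a c (2 * m + 1))"
    using assms unfolding has_irreducible_coupling_def by blast
  then have "has_irreducible_coupling a (Suc (2 * m + 1))"
    by (intro irreducible_coupling_extend[of "2 * m + 1" c a]) auto
  then show ?thesis by simp
qed

lemma irreducible_coupling_2: "has_irreducible_coupling a 2"
proof -
  have "irreducible (reduced_continuant a (\<lambda>_. 1) (2 * 0 + 1))"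
    by (subst irreducible_reduced_continuant_iff) auto
  then have "has_irreducible_coupling a (2 * 0 + 1)"
    unfolding has_irreducible_coupling_def by (intro exI[of _ "\<lambda>_. 1"]) simp
  from irreducible_coupling_extend_even[OF this] show ?thesis by (simp add: numeral_2_eq_2)
qed

text \<open>
  For odd size \<open>2 * m + 1\<close>, the first \<open>2 * m\<close> entries can be exceptional although the whole vector is not; then
  all odd entries but the last agree, and the reversed vector starts with two different odd entries. For even
  size, reversal reduces different even entries to different odd entries, and the last entry has even index and can
  be dropped.
\<close>

lemma irreducible_coupling_odd_even:
  assumes "m > 0"
  shows "((\<exists>i\<le>m. a (2 * i + 1) \<noteq> a 1) \<longrightarrow> has_irreducible_coupling a (2 * m + 1)) \<and>
    ((\<exists>i\<le>m. a (2 * i + 1) \<noteq> a 1) \<or> (\<exists>i\<le>m. a (2 * i + 2) \<noteq> a 2) \<longrightarrow>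
      has_irreducible_coupling a (2 * m + 2))"
  using assms
proof (induction m arbitrary: a rule: less_induct)
  case (less m)
  have odd: "has_irreducible_coupling a (2 * m + 1)" if ne: "\<exists>i\<le>m. a (2 * i + 1) \<noteq> a 1" for a
  proof -
    obtain k where k: "m = Suc k" using less.prems by (cases m) auto
    have ext: "has_irreducible_coupling b (2 * m + 1)"
      if b: "\<exists>i\<le>m. b (2 * i + 1) \<noteq> b 1" "has_irreducible_coupling b (2 * k + 2)" for b
    proof -
      have "\<exists>i\<le>k. b (2 * i + 1) \<noteq> b (2 * k + 3)"
      proof (rule ccontr)
        assume "\<not> ?thesis"
        then have *: "b (2 * i + 1) = b (2 * k + 3)" if "i \<le> k" for i using that by blast
        have "b (2 * i + 1) = b 1" if "i \<le> m" for i
          using *[of 0] *[of i] that by (cases "i = m") (auto simp: k numeral_3_eq_3)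
        with b(1) show False by blast
      qed
      from irreducible_coupling_extend_odd[OF b(2) this] show ?thesis
        by (simp add: k numeral_3_eq_3)
    qed
    show ?thesis
    proof (cases "k = 0")
      case True
      then show ?thesis using ext[OF ne] irreducible_coupling_2[of a] by (simp add: k numeral_2_eq_2)
    next
      case False
      show ?thesis
      proof (cases "\<exists>i\<le>k. a (2 * i + 1) \<noteq> a 1")
        case True
        then have "has_irreducible_coupling a (2 * k + 2)" using less.IH[of k a] False k by blast
        then show ?thesis using ext[OF ne] by simp
      next
        case eq: False
        define b where "b i = a (Suc (2 * m + 1) - i)" for i
        have "b 1 = a (2 * m + 1)" "b (2 * 1 + 1) = a (2 * k + 1)" by (simp_all add: b_def k)
        moreover have "a (2 * m + 1) \<noteq> a 1" using ne eq k by (metis le_SucE)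
        moreover have "a (2 * k + 1) = a 1" using eq by auto
        ultimately have b3: "b (2 * 1 + 1) \<noteq> b 1" by simp
        have "has_irreducible_coupling b (2 * k + 2)"
          using less.IH[of k b] False k b3 by (metis One_nat_def Suc_leI lessI neq0_conv)
        moreover have "\<exists>i\<le>m. b (2 * i + 1) \<noteq> b 1" using b3 k by (intro exI[of _ 1]) simp
        ultimately have "has_irreducible_coupling b (2 * m + 1)" by (intro ext)
        then show ?thesis unfolding b_def by (rule irreducible_coupling_reverse)
      qed
    qed
  qed
  have even: "has_irreducible_coupling a (2 * m + 2)"
    if ne: "(\<exists>i\<le>m. a (2 * i + 1) \<noteq> a 1) \<or> (\<exists>i\<le>m. a (2 * i + 2) \<noteq> a 2)"
  proof -
    show ?thesis
    proof (cases "\<exists>i\<le>m. a (2 * i + 1) \<noteq> a 1")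
      case True
      then show ?thesis using odd irreducible_coupling_extend_even by blast
    next
      case False
      define b where "b i = a (Suc (2 * m + 2) - i)" for i
      obtain i where i: "i \<le> m" "a (2 * i + 2) \<noteq> a 2" using ne False by blast
      have "\<exists>j\<le>m. b (2 * j + 1) \<noteq> b 1"
      proof (rule ccontr)
        assume "\<not> ?thesis"
        then have *: "b (2 * j + 1) = b 1" if "j \<le> m" for j using that by blast
        have "a (2 * j + 2) = b 1" if "j \<le> m" for j
        proof -
          have "Suc (2 * m + 2) - (2 * (m - j) + 1) = 2 * j + 2" using that by simp
          then have "a (2 * j + 2) = b (2 * (m - j) + 1)" unfolding b_def by (simp only:)
          then show ?thesis using *[of "m - j"] by simp
        qed
        from this[of i] this[of 0] i(1) have "a (2 * i + 2) = a (2 * 0 + 2)" by (simp only: le0)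
        with i(2) show False by (simp only: mult_0_right add_0)
      qed
      then have "has_irreducible_coupling b (2 * m + 2)"
        using odd irreducible_coupling_extend_even by blast
      then show ?thesis unfolding b_def by (rule irreducible_coupling_reverse)
    qed
  qed
  show ?case using odd even by blast
qed

lemma generic_irreducibility:
  assumes "n > 0" "has_irreducible_coupling a n"
  shows "for_generic (n - 1) (\<lambda>c. irreducible (reduced_continuant a c n))"
proof -
  obtain c0 where c0: "\<And>i. c0 i \<noteq> 0" "irreducible (reduced_continuant a c0 n)"
    using assms(2) unfolding has_irreducible_coupling_def by blast
  obtain D where D: "D \<in> polyfun {1..<n}" "D c0 \<noteq> 0"
    "\<And>c. D c \<noteq> 0 \<Longrightarrow> irreducible (reduced_continuant a c n)"
    using irreducible_reduced_continuant_is_open[OF assms(1) c0(2)] by blast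
  have "{1..<n} = {1..n - 1}" using assms(1) by auto
  then show ?thesis using D c0(1) by (intro for_genericI[of D _ c0]) auto
qed

lemma for_generic_everywhere: "(\<And>c. Q c) \<Longrightarrow> for_generic k Q"
  by (rule for_genericI[of "\<lambda>_. 1" _ "\<lambda>_. 1"]) (auto intro: polyfun.const)

lemma for_generic_mono: "for_generic k Q \<Longrightarrow> (\<And>c. Q c \<Longrightarrow> R c) \<Longrightarrow> for_generic k R"
  unfolding for_generic_def by blast

theorem theorem6p1:
  fixes a :: "nat \<Rightarrow> complex" and n m :: nat
  shows "(n = 2 * m + 1 \<and> n \<ge> 3 \<longrightarrow>
            for_generic (n - 1) (\<lambda>c. reducible (reduced_continuant a c n) \<longleftrightarrow>
              (\<forall>i \<in> {0..m}. a (2 * i + 1) = a 1)))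
       \<and> (n = 2 * m \<and> n \<ge> 4 \<longrightarrow>
            for_generic (n - 1) (\<lambda>c. reducible (reduced_continuant a c n) \<longleftrightarrow>
              (\<forall>i \<in> {1..m}. a (2 * i - 1) = a 1) \<and> (\<forall>i \<in> {1..m}. a (2 * i) = a 2)))"
proof (intro conjI impI; elim conjE)
  assume n: "n = 2 * m + 1" "n \<ge> 3"
  show "for_generic (n - 1) (\<lambda>c. reducible (reduced_continuant a c n) \<longleftrightarrow>
    (\<forall>i \<in> {0..m}. a (2 * i + 1) = a 1))"
  proof (cases "\<forall>i\<in>{0..m}. a (2 * i + 1) = a 1")
    case True
    then have "reducible (reduced_continuant a c n)" for c
      unfolding n(1) using n by (intro reducible_if_odd_entries_equal[where z = "a 1"]) auto
    then show ?thesis using True by (intro for_generic_everywhere) simp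
  next
    case False
    then have "\<exists>i\<le>m. a (2 * i + 1) \<noteq> a 1" by auto
    then have "has_irreducible_coupling a n"
      unfolding n(1) using n by (intro irreducible_coupling_odd_even[THEN conjunct1, rule_format]) auto
    then have "for_generic (n - 1) (\<lambda>c. irreducible (reduced_continuant a c n))"
      using n by (intro generic_irreducibility) auto
    then show ?thesis using False n
      by (elim for_generic_mono) (simp add: reducible_reduced_continuant_iff)
  qed
next
  assume n: "n = 2 * m" "n \<ge> 4"
  let ?A = "(\<forall>i\<in>{1..m}. a (2 * i - 1) = a 1) \<and> (\<forall>i\<in>{1..m}. a (2 * i) = a 2)"
  show "for_generic (n - 1) (\<lambda>c. reducible (reduced_continuant a c n) \<longleftrightarrow> ?A)"
  proof (cases ?A)
    case True
    have "a (2 * i + 1) = a 1" "a (2 * i + 2) = a 2" if "i < m" for i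
      using conjunct1[OF True, rule_format, of "Suc i"] conjunct2[OF True, rule_format, of "Suc i"] that
      by simp_all
    then have "reducible (reduced_continuant a c n)" for c
      unfolding n(1) using n
      by (intro reducible_if_entries_alternate[where y = "a 1" and z = "a 2"]) auto
    then show ?thesis using True by (intro for_generic_everywhere) blast
  next
    case False
    obtain k where k: "m = Suc k" "k > 0" using n by (cases m) auto
    have "(\<exists>i\<le>k. a (2 * i + 1) \<noteq> a 1) \<or> (\<exists>i\<le>k. a (2 * i + 2) \<noteq> a 2)"
    proof (rule ccontr)
      assume "\<not> ?thesis"
      then have "a (2 * i - 1) = a 1 \<and> a (2 * i) = a 2" if "i \<in> {1..m}" for i
        using that k(1) by (cases i) auto
      with False show False by blast
    qed
    then have "has_irreducible_coupling a (2 * k + 2)"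
      using k(2) by (intro irreducible_coupling_odd_even[THEN conjunct2, rule_format])
    then have "has_irreducible_coupling a n" by (simp add: n k)
    then have "for_generic (n - 1) (\<lambda>c. irreducible (reduced_continuant a c n))"
      using n by (intro generic_irreducibility) auto
    moreover have "reducible (reduced_continuant a c n) \<longleftrightarrow> ?A"
      if "irreducible (reduced_continuant a c n)" for c
      using that False n by (subst reducible_reduced_continuant_iff) auto
    ultimately show ?thesis by (rule for_generic_mono)
  qed
qed

end
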